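(* For all integers $n\ge 0$, the following congruences hold: \begin{align*} p_{-1/6}(25n+r)&\equiv 0 \pmod{25}, && r\in\{9,14,19,24\},\\ p_{1/6}(125n+r)&\equiv 0 \pmod{25}, && r\in\{96,121\},\\ p_{-5/6}(125n+r)&\equiv 0 \pmod{25}, && r\in\{95,120\},\\ p_{5/6}(25n+r)&\equiv 0 \pmod{125}, && r\in\{15,20\},\\ p_{5/6}(125n+r)&\equiv 0 \pmod{625}, && r\in\{65,70\}. \end{align*}
   Context: For a rational number $t\neq 0$, the rational numbers $p_t(n)$, $n\ge 0$, are defined by the formal power series identity $\sum_{n\ge 0}p_t(n)q^n=\prod_{j\ge 1}(1-q^j)^t$, where each factor $(1-q^j)^t$ is the binomial series with constant term $1$. For a prime $\ell$ not dividing the denominator of $t$, a congruence $p_t(N)\equiv 0\pmod{\ell^k}$ means that the numerator of $p_t(N)$, written as a reduced fraction, is divisible by $\ell^k$ (the denominator of $p_t(N)$ is then coprime to $\ell$). *)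

theory Defs
  imports "HOL-Analysis.Analysis" "HOL-Computational_Algebra.Formal_Power_Series"
begin

text \<open>
  The factor \<open>(1 - q^j)^t\<close> is the composition of the binomial series
  \<open>(1 + q)^t = (\<Sum>k. (t gchoose k) * q^k)\<close> with \<open>- q^j\<close>. The infinite product is taken in
  the topology on \<^typ>\<open>rat fps\<close> given by coefficientwise stabilisation.
\<close>

definition euler_factor :: "rat \<Rightarrow> nat \<Rightarrow> rat fps" where
  "euler_factor t j = fps_binomial t oo (- (fps_X ^ j))"

definition p_pow :: "rat \<Rightarrow> nat \<Rightarrow> rat" where
  "p_pow t n = fps_nth (\<Prod>j. euler_factor t (Suc j)) n"

text \<open>
  The infinite product converges, so the unique-choice operator behind its notation does denote
  the intended limit.
\<close>

lemma euler_factor_nth_0: "fps_nth (euler_factor t j) 0 = 1"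
  by (simp add: euler_factor_def)

lemma euler_factor_nth_less:
  assumes "0 < i" "i < j"
  shows "fps_nth (euler_factor t j) i = 0"
proof -
  have "fps_nth ((- (fps_X ^ j) :: rat fps) ^ k) i = 0" for k
  proof (cases "k = 0")
    case True
    then show ?thesis
      using assms by simp
  next
    case False
    have "(- (fps_X ^ j) :: rat fps) ^ k = (- 1) ^ k * (fps_X ^ j) ^ k"
      by (rule power_minus)
    also have "\<dots> = fps_const ((- 1) ^ k) * fps_X ^ (j * k)"
      by (simp only: fps_const_power [symmetric] fps_const_neg [symmetric] fps_const_1_eq_1
        power_mult)
    finally have "(- (fps_X ^ j) :: rat fps) ^ k = fps_const ((- 1) ^ k) * fps_X ^ (j * k)" .
    moreover have "i < j * k"
    proof -
      have "j * 1 \<le> j * k"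
        using False by (intro mult_le_mono2) simp
      then show ?thesis
        using assms by linarith
    qed
    ultimately show ?thesis
      by (simp only: fps_mult_left_const_nth fps_X_power_nth) simp
  qed
  then show ?thesis
    by (simp add: euler_factor_def fps_compose_nth)
qed

lemma euler_partial_stable:
  assumes "m \<le> n"
  shows "fps_nth (\<Prod>j\<le>n. euler_factor t (Suc j)) m = fps_nth (\<Prod>j\<le>m. euler_factor t (Suc j)) m"
  using assms
proof (induction n rule: dec_induct)
  case base
  show ?case ..
next
  case (step n)
  have "fps_nth (\<Prod>j\<le>Suc n. euler_factor t (Suc j)) m =
      (\<Sum>i=0..m. fps_nth (\<Prod>j\<le>n. euler_factor t (Suc j)) i *
        fps_nth (euler_factor t (Suc (Suc n))) (m - i))"
    by (simp add: fps_mult_nth)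
  also have "\<dots> = (\<Sum>i=0..m. if i = m then fps_nth (\<Prod>j\<le>n. euler_factor t (Suc j)) m else 0)"
    using step.hyps
    by (intro sum.cong) (auto simp: euler_factor_nth_0 intro!: euler_factor_nth_less)
  also have "\<dots> = fps_nth (\<Prod>j\<le>n. euler_factor t (Suc j)) m"
    by simp
  finally show ?case
    using step.IH by simp
qed

lemma euler_factor_has_prod:
  "(\<lambda>j. euler_factor t (Suc j)) has_prod (\<Prod>j. euler_factor t (Suc j))"
proof -
  define L where "L = Abs_fps (\<lambda>m. fps_nth (\<Prod>j\<le>m. euler_factor t (Suc j)) m)"
  have "(\<lambda>n. \<Prod>j\<le>n. euler_factor t (Suc j)) \<longlonglongrightarrow> L"
  proof (rule tendsto_fpsI)
    fix m
    show "eventually (\<lambda>n. fps_nth (\<Prod>j\<le>n. euler_factor t (Suc j)) m = fps_nth L m) sequentially"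
      using eventually_ge_at_top[of m]
      by eventually_elim (simp only: L_def fps_nth_Abs_fps, rule euler_partial_stable)
  qed
  moreover have "fps_nth L 0 = 1"
    by (simp add: L_def euler_factor_nth_0)
  then have "L \<noteq> 0"
    by auto
  ultimately have "(\<lambda>j. euler_factor t (Suc j)) has_prod L"
    by (simp add: has_prod_def raw_has_prod_def)
  moreover have "L' = L" if "(\<lambda>j. euler_factor t (Suc j)) has_prod L'" for L'
  proof -
    have nz: "euler_factor t (Suc i) \<noteq> 0" for i
      using euler_factor_nth_0[of t "Suc i"] by auto
    then have "raw_has_prod (\<lambda>j. euler_factor t (Suc j)) 0 L'"
      using that by (auto simp: has_prod_def)
    then show ?thesis
      using \<open>(\<lambda>n. \<Prod>j\<le>n. euler_factor t (Suc j)) \<longlonglongrightarrow> L\<close>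
      by (auto simp: raw_has_prod_def intro: LIMSEQ_unique)
  qed
  ultimately have "prodinf (\<lambda>j. euler_factor t (Suc j)) = L"
    unfolding prodinf_def by (intro the_equality)
  with \<open>(\<lambda>j. euler_factor t (Suc j)) has_prod L\<close> show ?thesis
    by simp
qed

text \<open>
  \<^const>\<open>quotient_of\<close> yields the reduced fraction with positive denominator, so the condition is on the reduced numerator.
\<close>

definition rat_cong_0 :: "rat \<Rightarrow> int \<Rightarrow> bool" (\<open>(1[_ = 0] '(ratmod _'))\<close>) where
  "[x = 0] (ratmod m) \<longleftrightarrow> m dvd fst (quotient_of x)"

end

theory Submission
  imports Defs "HOL-Computational_Algebra.Formal_Laurent_Series" "HOL-Number_Theory.Cong"
begin

text \<open>
  Let \<open>E = \<Prod>(1 - q^j)\<close>. The coefficient \<open>p_pow t N\<close> is a polynomial in \<open>t\<close>, so \<open>t = a/6\<close> may be replaced by a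
  natural number \<open>s\<close> that is 5-adically close to it, and the claims become congruences for the integral
  series \<open>E^s\<close>. Split \<open>E = A0 + A1 + A2\<close> by exponents modulo 5. The pentagonal number theorem gives
  \<open>A1 = - q E(q^25)\<close>, a sign-reversing reflection of a lattice gives \<open>A0 A2 = - A1^2\<close>, and the product of \<open>E(w q)\<close>
  over the fifth roots of unity \<open>w\<close> gives \<open>A0^5 + 11 A1^5 + A2^5 = E(q^5)^6 / E(q^25)\<close>. This determines, modulo
  powers of 5, the parts of \<open>E^4\<close>, \<open>E^20\<close>, \<open>E^21\<close>, \<open>E^105\<close> and \<open>1/E\<close> supported on suitable residue classes modulo 5 as
  products of \<open>E(q)\<close>, \<open>E(q^5)\<close>, \<open>E(q^25)\<close>. Together with \<open>E(q)^(5^k) \<equiv> E(q^5)^(5^(k-1)) (mod 5^k)\<close> this reduces every claim to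
  the vanishing of coefficients of a series in \<open>q^5\<close>, or of such a series times \<open>E\<close>, which has no exponents congruent
  to 3 or 4 modulo 5.
\<close>

section \<open>Reduction to powers of the integral Euler product\<close>

definition agree :: "nat \<Rightarrow> 'a::comm_ring_1 fps \<Rightarrow> 'a fps \<Rightarrow> bool" where
  "agree n f g \<longleftrightarrow> (\<forall>i\<le>n. fps_nth f i = fps_nth g i)"

lemma agree_refl [simp]: "agree n f f"
  by (simp add: agree_def)

lemma agree_sym: "agree n f g \<Longrightarrow> agree n g f"
  by (simp add: agree_def)

lemma agree_trans: "agree n f g \<Longrightarrow> agree n g h \<Longrightarrow> agree n f h"
  by (simp add: agree_def)

lemma agree_mult: "agree n f g \<Longrightarrow> agree n h k \<Longrightarrow> agree n (f * h) (g * k)"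
  unfolding agree_def fps_mult_nth by (auto intro!: sum.cong)

lemma agree_power: "agree n f g \<Longrightarrow> agree n (f ^ k) (g ^ k)"
  by (induction k) (auto intro: agree_mult)

lemma agree_compose_X_power: "agree n f g \<Longrightarrow> agree n (f oo fps_X ^ d) (g oo fps_X ^ d)"
  unfolding agree_def fps_nth_compose_X_power
  by (auto intro!: order.trans[OF div_le_dividend])

lemma agree_all_imp_eq: "(\<And>n. agree n f g) \<Longrightarrow> f = g"
  by (rule fps_ext) (auto simp: agree_def)

lemma one_minus_fps_X_power_agree_1: "n < d \<Longrightarrow> agree n (1 - fps_X ^ d) 1"
  by (auto simp: agree_def)

section \<open>The Euler product with integer coefficients\<close>

definition euler_partial :: "nat \<Rightarrow> int fps" where
  "euler_partial n = (\<Prod>j<n. 1 - fps_X ^ Suc j)"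

text \<open>The infinite product is encoded diagonally: all factors after the first \<open>n\<close>
  are 1 modulo q^(n+1), so \<open>euler_partial n\<close> already has the final coefficient in
  degree \<open>n\<close>.\<close>

definition euler :: "int fps" where
  "euler = Abs_fps (\<lambda>n. fps_nth (euler_partial n) n)"

lemma euler_partial_Suc: "euler_partial (Suc n) = euler_partial n * (1 - fps_X ^ Suc n)"
  by (simp add: euler_partial_def)

lemma euler_partial_agree_partial: "m \<le> n \<Longrightarrow> agree m (euler_partial n) (euler_partial m)"
proof (induction n rule: dec_induct)
  case (step n)
  have "agree m (euler_partial n * (1 - fps_X ^ Suc n)) (euler_partial m * 1)"
    using step by (intro agree_mult one_minus_fps_X_power_agree_1) auto
  then show ?case
    by (simp only: euler_partial_Suc mult_1_right)
qed simp

lemma euler_partial_agree: "m \<le> n \<Longrightarrow> agree m (euler_partial n) euler"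
  using euler_partial_agree_partial[of _ n] unfolding agree_def euler_def
  by (metis fps_nth_Abs_fps order.trans order_refl)

definition int_fps :: "int fps \<Rightarrow> 'a::comm_ring_1 fps" where
  "int_fps f = Abs_fps (\<lambda>n. of_int (fps_nth f n))"

lemma int_fps_nth [simp]: "fps_nth (int_fps f) n = of_int (fps_nth f n)"
  by (simp add: int_fps_def)

lemma int_fps_1 [simp]: "int_fps 1 = 1"
  by (rule fps_ext) simp

lemma int_fps_numeral [simp]: "int_fps (numeral k) = numeral k"
  by (rule fps_ext) (simp add: numeral_fps_const)

lemma int_fps_add [simp]: "int_fps (f + g) = int_fps f + int_fps g"
  by (rule fps_ext) simp

lemma int_fps_minus [simp]: "int_fps (f - g) = int_fps f - int_fps g"
  by (rule fps_ext) simp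

lemma int_fps_uminus [simp]: "int_fps (- f) = - int_fps f"
  by (rule fps_ext) simp

lemma int_fps_mult [simp]: "int_fps (f * g) = int_fps f * int_fps g"
  by (rule fps_ext) (simp add: fps_mult_nth)

lemma int_fps_power [simp]: "int_fps (f ^ n) = int_fps f ^ n"
  by (induction n) simp_all

lemma int_fps_prod [simp]: "int_fps (prod f A) = (\<Prod>x\<in>A. int_fps (f x))"
  by (induction A rule: infinite_finite_induct) simp_all

lemma int_fps_X [simp]: "int_fps fps_X = fps_X"
  by (rule fps_ext) (simp add: fps_X_nth)

lemma int_fps_agree: "agree n f g \<Longrightarrow> agree n (int_fps f) (int_fps g)"
  by (simp add: agree_def)

section \<open>Dependence of a coefficient on the exponent\<close>

lemma p_pow_eq_partial:
  "p_pow t n = fps_nth (\<Prod>j\<le>n. euler_factor t (Suc j)) n"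
proof -
  have nz: "euler_factor t (Suc i) \<noteq> 0" for i
    using euler_factor_nth_0[of t "Suc i"] by auto
  have "raw_has_prod (\<lambda>j. euler_factor t (Suc j)) 0 (\<Prod>j. euler_factor t (Suc j))"
    using euler_factor_has_prod[of t] nz by (auto simp: has_prod_def)
  then have "(\<lambda>m. \<Prod>j\<le>m. euler_factor t (Suc j)) \<longlonglongrightarrow> (\<Prod>j. euler_factor t (Suc j))"
    by (simp add: raw_has_prod_def)
  then have "eventually (\<lambda>m. fps_nth (\<Prod>j\<le>m. euler_factor t (Suc j)) n = p_pow t n) sequentially"
    unfolding p_pow_def tendsto_fps_iff by blast
  then obtain m where "m \<ge> n" "fps_nth (\<Prod>j\<le>m. euler_factor t (Suc j)) n = p_pow t n"
    unfolding eventually_sequentially by (meson nat_le_linear order_refl)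
  then show ?thesis
    using euler_partial_stable by metis
qed

lemma euler_factor_of_nat: "0 < j \<Longrightarrow> euler_factor (of_nat s) j = int_fps (1 - fps_X ^ j) ^ s"
  by (simp add: euler_factor_def fps_binomial_of_nat fps_compose_add_distrib
      flip: fps_compose_power)

text \<open>The only features of a polynomial with rational coefficients that the reduction needs.\<close>

definition quasi_int :: "(int \<Rightarrow> rat) \<Rightarrow> bool" where
  "quasi_int f \<longleftrightarrow> (\<exists>C>0. \<exists>R. (\<forall>y z. y - z dvd R y - R z) \<and> (\<forall>y. of_int C * f y = of_int (R y)))"

lemma quasi_intI:
  assumes "C > 0" "\<And>y z. y - z dvd R y - R z" "\<And>y. of_int C * f y = of_int (R y)"
  shows "quasi_int f"
  using assms unfolding quasi_int_def by blast

lemma quasi_int_const: "quasi_int (\<lambda>_. c)"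
proof (cases c)
  case (Fract a b)
  show ?thesis
    by (rule quasi_intI[of b "\<lambda>_. a"]) (use Fract in \<open>auto simp: Fract_of_int_quotient\<close>)
qed

lemma quasi_int_divide: "m > 0 \<Longrightarrow> quasi_int (\<lambda>y. of_int y / of_nat m)"
  by (rule quasi_intI[of "int m" "\<lambda>y. y"]) auto

lemma quasi_int_add:
  assumes "quasi_int f" "quasi_int g"
  shows "quasi_int (\<lambda>y. f y + g y)"
proof -
  obtain C R D S where *: "C > 0" "\<And>y z. y - z dvd R y - R z" "\<And>y. of_int C * f y = of_int (R y)"
    "D > 0" "\<And>y z. y - z dvd S y - S z" "\<And>y. of_int D * g y = of_int (S y)"
    using assms unfolding quasi_int_def by blast
  show ?thesis
  proof (rule quasi_intI[of "C * D" "\<lambda>y. D * R y + C * S y"])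
    fix y z
    have "y - z dvd D * (R y - R z) + C * (S y - S z)"
      using * by (intro dvd_add dvd_mult) auto
    then show "y - z dvd D * R y + C * S y - (D * R z + C * S z)"
      by (simp add: algebra_simps)
    show "of_int (C * D) * (f y + g y) = of_int (D * R y + C * S y)"
      using *(3)[of y] *(6)[of y] by (simp add: algebra_simps flip: *(3) *(6))
  qed (use * in auto)
qed

lemma quasi_int_mult:
  assumes "quasi_int f" "quasi_int g"
  shows "quasi_int (\<lambda>y. f y * g y)"
proof -
  obtain C R D S where *: "C > 0" "\<And>y z. y - z dvd R y - R z" "\<And>y. of_int C * f y = of_int (R y)"
    "D > 0" "\<And>y z. y - z dvd S y - S z" "\<And>y. of_int D * g y = of_int (S y)"
    using assms unfolding quasi_int_def by blast
  show ?thesis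
  proof (rule quasi_intI[of "C * D" "\<lambda>y. R y * S y"])
    fix y z
    have "y - z dvd (R y - R z) * S y + R z * (S y - S z)"
      using * by (intro dvd_add dvd_mult dvd_mult2) auto
    then show "y - z dvd R y * S y - R z * S z"
      by (simp add: algebra_simps)
    show "of_int (C * D) * (f y * g y) = of_int (R y * S y)"
      by (simp add: algebra_simps flip: *(3) *(6))
  qed (use * in auto)
qed

lemma quasi_int_sum: "(\<And>i. i \<in> A \<Longrightarrow> quasi_int (f i)) \<Longrightarrow> quasi_int (\<lambda>y. \<Sum>i\<in>A. f i y)"
  by (induction A rule: infinite_finite_induct) (auto intro: quasi_int_const quasi_int_add)

lemma quasi_int_prod: "(\<And>i. i \<in> A \<Longrightarrow> quasi_int (f i)) \<Longrightarrow> quasi_int (\<lambda>y. \<Prod>i\<in>A. f i y)"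
  by (induction A rule: infinite_finite_induct) (auto intro: quasi_int_const quasi_int_mult)

text \<open>A binomial coefficient is a falling factorial times the constant 1/k!, so the closure
  rules apply and the factorial is absorbed into the common denominator.\<close>

lemma quasi_int_gbinomial:
  assumes "quasi_int f"
  shows "quasi_int (\<lambda>y. f y gchoose k)"
proof -
  have "quasi_int (\<lambda>y. (\<Prod>i = 0..<k. f y + - of_nat i) * inverse (fact k))"
    using assms by (intro quasi_int_mult quasi_int_prod quasi_int_add quasi_int_const)
  then show ?thesis
    by (simp add: gbinomial_prod_rev divide_inverse)
qed

lemma quasi_int_euler_factor:
  assumes "quasi_int f"
  shows "quasi_int (\<lambda>y. fps_nth (euler_factor (f y) j) n)"
  unfolding euler_factor_def fps_compose_nth fps_binomial_nth
  using assms by (intro quasi_int_sum quasi_int_mult quasi_int_gbinomial quasi_int_const)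

lemma quasi_int_fps_prod:
  assumes "\<And>i n. quasi_int (\<lambda>y. fps_nth (F i y) n)" "finite A"
  shows "quasi_int (\<lambda>y. fps_nth (\<Prod>i\<in>A. F i y) n)"
  using assms(2)
proof (induction arbitrary: n rule: finite_induct)
  case (insert x A)
  then show ?case
    by (simp add: fps_mult_nth) (intro quasi_int_sum quasi_int_mult assms(1) insert.IH)
qed (simp add: quasi_int_const)

lemma p_pow_of_nat: "p_pow (of_nat s) n = of_int (fps_nth (euler ^ s) n)"
proof -
  have "(\<Prod>j\<le>n. euler_factor (of_nat s) (Suc j)) = int_fps (euler_partial (Suc n)) ^ s"
    by (simp only: euler_factor_of_nat zero_less_Suc prod_power_distrib [symmetric]
        euler_partial_def int_fps_prod lessThan_Suc_atMost)
  also have "\<dots> = int_fps (euler_partial (Suc n) ^ s)"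
    by simp
  finally have "p_pow (of_nat s) n = of_int (fps_nth (euler_partial (Suc n) ^ s) n)"
    by (simp add: p_pow_eq_partial del: int_fps_power)
  also have "agree n (euler_partial (Suc n) ^ s) (euler ^ s)"
    by (intro agree_power euler_partial_agree) simp
  then have "fps_nth (euler_partial (Suc n) ^ s) n = fps_nth (euler ^ s) n"
    by (simp add: agree_def)
  finally show ?thesis .
qed

text \<open>Continuity in the exponent with respect to \<open>p\<close>: choose a natural number
  \<open>s\<close> with \<open>b * s\<close> close to \<open>a\<close>. The cleared numerator
  \<open>R\<close> respects congruences, so divisibility at \<open>s\<close>, where the coefficient
  belongs to \<open>euler ^ s\<close>, passes to \<open>a / b\<close>.\<close>

lemma p_pow_ratmod_transfer:
  fixes a :: int and b s0 e k N p :: nat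
  assumes p: "prime p" "\<not> p dvd b" and s0: "[int (b * s0) = a] (mod int p ^ e)"
    and dvd: "\<And>w. int p ^ k dvd fps_nth (euler ^ (s0 + p ^ e * w)) N"
  shows "[p_pow (of_int a / of_nat b) N = 0] (ratmod (int p ^ k))"
proof -
  have b: "b > 0"
    using p by (intro Nat.gr0I) auto
  have "quasi_int (\<lambda>y. p_pow (of_int y / of_nat b) N)"
    unfolding p_pow_eq_partial
    by (intro quasi_int_fps_prod quasi_int_euler_factor quasi_int_divide b finite_atMost)
  then obtain C R where C: "C > 0" and R: "\<And>y z. y - z dvd R y - R z"
    and CR: "\<And>y. of_int C * p_pow (of_int y / of_nat b) N = of_int (R y)"
    unfolding quasi_int_def by blast
  define v where "v = multiplicity (int p) C"
  obtain C' where C': "C = int p ^ v * C'" "\<not> int p dvd C'"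
    unfolding v_def using C p by (elim multiplicity_decompose'[rotated 2]) auto
  \<comment> \<open>The part \<open>e\<close> keeps \<open>s\<close> in the class of
    \<open>s0\<close>, \<open>k\<close> is the divisibility wanted, and \<open>v\<close> pays for
    the power of \<open>p\<close> in the denominator \<open>C\<close>.\<close>
  define M where "M = e + k + v"
  have cop: "coprime (int b) (int p ^ m)" for m
    using p by (metis coprime_commute coprime_int_iff coprime_power_right_iff prime_imp_coprime)
  then obtain x where x: "[int b * x = 1] (mod int p ^ M)"
    using cong_solve_coprime_int by blast
  \<comment> \<open>Since \<open>x\<close> inverts \<open>b\<close>, the first summand represents
    \<open>a / b\<close>. The second does not change the residue but ensures
    \<open>s0 \<le> s\<close>, so that \<open>s = s0 + p ^ e * w\<close> with a natural number
    \<open>w\<close>.\<close>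
  define s where "s = nat ((x * a) mod int p ^ M) + p ^ M * s0"
  have pM: "int p ^ M > 0"
    using p prime_gt_0_nat by simp
  have "[int s = x * a] (mod int p ^ M)"
    using pM by (simp add: s_def cong_def)
  then have "[int b * int s = int b * (x * a)] (mod int p ^ M)"
    by (rule cong_scalar_left)
  also have "[int b * (x * a) = 1 * a] (mod int p ^ M)"
    unfolding mult.assoc [symmetric] using x by (rule cong_scalar_right)
  finally have bs: "[int b * int s = a] (mod int p ^ M)"
    by simp
  have "[int b * int s = int b * int s0] (mod int p ^ e)"
    using cong_dvd_modulus[OF bs, of "int p ^ e"] s0
    by (metis M_def cong_sym cong_trans le_imp_power_dvd nat_le_iff_add add.assoc of_nat_mult)
  then have "[int s = int s0] (mod int p ^ e)"
    using cop by (simp add: cong_mult_lcancel)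
  moreover have "s0 \<le> s"
    using p prime_gt_0_nat by (simp add: s_def trans_le_add2 Suc_leI)
  ultimately have "p ^ e dvd s - s0"
    by (metis cong_altdef_nat cong_int_iff of_nat_power)
  then obtain w where w: "s = s0 + p ^ e * w"
    using \<open>s0 \<le> s\<close> by (metis dvdE le_add_diff_inverse)
  have "R (int (b * s)) = C * fps_nth (euler ^ s) N"
  proof -
    have "of_int (int (b * s)) / of_nat b = (of_nat s :: rat)"
      using b by simp
    with CR[of "int (b * s)"] have "(of_int (C * fps_nth (euler ^ s) N) :: rat) = of_int (R (int (b * s)))"
      by (simp only: p_pow_of_nat of_int_mult)
    then show ?thesis
      by (simp only: of_int_eq_iff)
  qed
  then have "int p ^ (v + k) dvd R (int (b * s))"
    using dvd[of w] by (simp add: w C' power_add mult_dvd_mono mult.assoc)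
  moreover have "int p ^ (v + k) dvd R (int (b * s)) - R a"
  proof -
    have "int p ^ (v + k) dvd int p ^ M"
      by (intro le_imp_power_dvd) (simp add: M_def)
    also have "\<dots> dvd int (b * s) - a"
      using bs by (simp add: cong_iff_dvd_diff)
    also have "\<dots> dvd R (int (b * s)) - R a"
      by (rule R)
    finally show ?thesis .
  qed
  ultimately have "int p ^ (v + k) dvd R a"
    by (simp add: dvd_diff_right_iff)
  then obtain z where z: "R a = int p ^ (v + k) * z" ..
  obtain n d where nd: "quotient_of (p_pow (of_int a / of_nat b) N) = (n, d)"
    by (cases "quotient_of (p_pow (of_int a / of_nat b) N)")
  have "d > 0"
    using nd by (rule quotient_of_denom_pos)
  have "of_int C * (of_int n / of_int d :: rat) = of_int (R a)"
    using CR[of a] by (simp only: quotient_of_div[OF nd])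
  then have "(of_int (C * n) :: rat) = of_int (R a * d)"
    using \<open>d > 0\<close> by (simp add: field_simps)
  then have "C * n = R a * d"
    by (simp only: of_int_eq_iff)
  then have "int p ^ v * (C' * n) = int p ^ v * (int p ^ k * (z * d))"
    by (simp add: C' z power_add mult_ac)
  then have "C' * n = int p ^ k * (z * d)"
    using p prime_gt_0_nat by (simp add: mult_left_cancel)
  then have "int p ^ k dvd C' * n"
    by simp
  moreover have "coprime (int p ^ k) C'"
    using p C' by (simp add: prime_imp_coprime)
  ultimately have "int p ^ k dvd n"
    by (simp add: coprime_dvd_mult_right_iff)
  then show ?thesis
    by (simp add: rat_cong_0_def nd)
qed

section \<open>The pentagonal number theorem\<close>

text \<open>Shanks's finite form of the pentagonal number theorem. Passing from \<open>n\<close> to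
  \<open>n + 1\<close> changes the summand with index \<open>j\<close> by
  \<open>G (Suc j) - G j\<close>. The telescoped sum gives one of the two new terms, and the
  additional summand \<open>j = n + 1\<close> gives the other.\<close>

lemma shanks_telescope:
  fixes P :: "nat \<Rightarrow> nat \<Rightarrow> 'a::comm_ring_1" and x :: 'a
  defines "T \<equiv> \<lambda>j. j * (j + 1) div 2"
  defines "P \<equiv> \<lambda>j n. \<Prod>i = Suc j..n. 1 - x ^ i"
  defines "F \<equiv> \<lambda>n. \<Sum>j\<le>n. (- 1) ^ j * P j n * x ^ (j * n + T j)"
  shows "F (Suc n) = F n + (- 1) ^ Suc n * (x ^ (Suc n * Suc n + T (Suc n)) + x ^ (Suc n * Suc n + T n))"
proof -
  define N where "N = Suc n"
  \<comment> \<open>The value 0 at \<open>j = 0\<close>, where the product would contain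
    \<open>1 - x ^ 0\<close>, removes the lower boundary term of the telescope; at
    \<open>j = N\<close> the product is empty.\<close>
  define G where "G = (\<lambda>j. if j = 0 then 0 else (- 1) ^ j * (\<Prod>i = j..n. 1 - x ^ i) * x ^ (j * N + T (j - 1)))"
  have T: "T (Suc j) = T j + Suc j" for j
    by (simp add: T_def)
  have step: "(- 1) ^ j * P j N * x ^ (j * N + T j) - (- 1) ^ j * P j n * x ^ (j * n + T j) = G (Suc j) - G j"
    if "j \<le> n" for j
  proof -
    have PN: "P j N = P j n * (1 - x ^ N)"
      using that by (simp add: P_def N_def)
    have 1: "x ^ (Suc j * N + T j) = x ^ (j * N + T j) * x ^ N"
      by (simp add: power_add mult_ac)
    have 2: "G (Suc j) = - ((- 1) ^ j * P j n * x ^ (j * N + T j) * x ^ N)"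
      unfolding G_def using 1 by (simp add: P_def)
    show ?thesis
    proof (cases j)
      case 0
      then show ?thesis
        unfolding 2 PN by (simp add: G_def T_def algebra_simps)
    next
      case (Suc i)
      have "(\<Prod>i = j..n. 1 - x ^ i) = (1 - x ^ j) * P j n"
        using that by (simp add: P_def prod.atLeast_Suc_atMost)
      then have 3: "G j = (- 1) ^ j * ((1 - x ^ j) * P j n) * x ^ (j * n + T j)"
        by (simp add: G_def Suc T N_def power_add mult_ac)
      have 4: "x ^ (j * N + T j) = x ^ (j * n + T j) * x ^ j"
        by (simp add: N_def power_add mult_ac)
      show ?thesis
        unfolding 2 PN 3 4 by (simp add: algebra_simps)
    qed
  qed
  have eq: "p = s + a \<Longrightarrow> s - f = d \<Longrightarrow> d = g \<Longrightarrow> g = b \<Longrightarrow> p = f + (a + b)" for p s a f d g b :: 'a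
    by (simp add: algebra_simps)
  have "F N = F n + ((- 1) ^ N * x ^ (N * N + T N) + (- 1) ^ N * x ^ (N * N + T n))"
  proof (rule eq)
    show "F N = (\<Sum>j\<le>n. (- 1) ^ j * P j N * x ^ (j * N + T j)) + (- 1) ^ N * x ^ (N * N + T N)"
      by (simp add: F_def N_def P_def)
    show "(\<Sum>j\<le>n. (- 1) ^ j * P j N * x ^ (j * N + T j)) - F n = (\<Sum>j\<le>n. G (Suc j) - G j)"
      unfolding F_def by (simp add: step flip: sum_subtractf)
    show "(\<Sum>j\<le>n. G (Suc j) - G j) = G N"
      using sum_lessThan_telescope[of G N] by (simp add: N_def lessThan_Suc_atMost G_def)
    show "G N = (- 1) ^ N * x ^ (N * N + T n)"
      by (simp add: G_def N_def)
  qed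
  then show ?thesis
    by (simp only: N_def distrib_left)
qed

section \<open>Generalised pentagonal numbers and their signed series\<close>

definition pent :: "int \<Rightarrow> nat" where
  "pent k = nat (k * (3 * k - 1) div 2)"

definition alt :: "int \<Rightarrow> int" where
  "alt k = (if even k then 1 else - 1)"

text \<open>The doubled form turns identities between values of \<open>pent\<close> into polynomial
  identities, free of \<open>nat\<close> and \<open>div\<close>.\<close>

lemma pent_double: "2 * int (pent k) = k * (3 * k - 1)"
proof -
  have "k * (3 * k - 1) \<ge> 0"
    by (cases "k \<ge> 1") (auto simp: zero_le_mult_iff)
  moreover have "even (k * (3 * k - 1))"
    by simp
  ultimately show ?thesis
    by (simp add: pent_def)
qed

text \<open>This makes the fibres of \<open>pent\<close> finite and confines the indices of degree
  at most \<open>n\<close> to the interval from \<open>- n\<close> to \<open>n\<close>.\<close>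

lemma abs_le_pent: "\<bar>k\<bar> \<le> int (pent k)"
proof (cases "k \<ge> 1")
  case True
  have "k * 2 \<le> k * (3 * k - 1)"
    using True by (intro mult_left_mono) auto
  then show ?thesis
    using True pent_double[of k] by linarith
next
  case False
  have "0 \<le> k * (k + 1)"
    using False by (cases "k = 0") (auto simp: zero_le_mult_iff)
  then show ?thesis
    using False pent_double[of k] by (simp add: algebra_simps)
qed

lemma finite_pent_eq [simp]: "finite {k. pent k = N}"
proof (rule finite_subset)
  show "{k. pent k = N} \<subseteq> {- int N..int N}"
  proof
    fix k assume "k \<in> {k. pent k = N}"
    then show "k \<in> {- int N..int N}"
      using abs_le_pent[of k] by auto
  qed
qed simp

lemma finite_pent_eq_restrict [simp]: "finite {k \<in> S. pent k = N}"
  by (rule finite_subset[OF _ finite_pent_eq[of N]]) auto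

definition theta :: "int set \<Rightarrow> int fps" where
  "theta S = Abs_fps (\<lambda>N. \<Sum>k\<in>{k \<in> S. pent k = N}. alt k)"

lemma theta_nth: "fps_nth (theta S) N = (\<Sum>k\<in>{k \<in> S. pent k = N}. alt k)"
  by (simp add: theta_def)

lemma theta_union:
  assumes "S \<inter> T = {}"
  shows "theta (S \<union> T) = theta S + theta T"
proof (rule fps_ext)
  fix N
  have "{k \<in> S \<union> T. pent k = N} = {k \<in> S. pent k = N} \<union> {k \<in> T. pent k = N}"
    by auto
  then show "fps_nth (theta (S \<union> T)) N = fps_nth (theta S + theta T) N"
    using assms by (simp add: theta_nth) (intro sum.union_disjoint, auto)
qed

text \<open>One of the two new exponents in \<open>shanks_telescope\<close> is pentagonal with index
  \<open>n + 1\<close>; the other has index \<open>- (n + 1)\<close>, by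
  \<open>pent_minus_of_nat\<close>.\<close>

lemma pent_of_nat: "pent (int (Suc n)) = Suc n * Suc n + n * (n + 1) div 2"
proof -
  have "2 * (n * (n + 1) div 2) = n * (n + 1)"
    by simp
  then have "2 * int (n * (n + 1) div 2) = int n * (int n + 1)"
    by (metis of_nat_1 of_nat_add of_nat_mult of_nat_numeral)
  then have "2 * int (pent (int (Suc n))) = 2 * int (Suc n * Suc n + n * (n + 1) div 2)"
    unfolding pent_double by (simp add: algebra_simps)
  then show ?thesis
    by (simp only: mult_cancel_left of_nat_eq_iff) simp
qed

lemma pent_minus_of_nat: "pent (- int n) = n * n + n * (n + 1) div 2"
proof -
  have "2 * (n * (n + 1) div 2) = n * (n + 1)"
    by simp
  then have "2 * int (n * (n + 1) div 2) = int n * (int n + 1)"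
    by (metis of_nat_1 of_nat_add of_nat_mult of_nat_numeral)
  then have "2 * int (pent (- int n)) = 2 * int (n * n + n * (n + 1) div 2)"
    unfolding pent_double by (simp add: algebra_simps)
  then show ?thesis
    by (simp only: mult_cancel_left of_nat_eq_iff) simp
qed

lemma alt_of_nat: "alt (int n) = (- 1) ^ n" "alt (- int n) = (- 1) ^ n"
  by (auto simp: alt_def)

lemma pentagonal_partial:
  "(\<Sum>j\<le>n. (- 1) ^ j * (\<Prod>i = Suc j..n. 1 - fps_X ^ i) * fps_X ^ (j * n + j * (j + 1) div 2)) =
    (\<Sum>k = - int n..int n. of_int (alt k) * fps_X ^ pent k :: int fps)"
proof (induction n)
  case 0
  then show ?case
    by (simp add: alt_def pent_def)
next
  case (Suc n)
  have "{- int (Suc n)..int (Suc n)} = insert (- int (Suc n)) (insert (int (Suc n)) {- int n..int n})"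
    by auto
  then have "(\<Sum>k = - int (Suc n)..int (Suc n). of_int (alt k) * fps_X ^ pent k :: int fps) =
      (\<Sum>k = - int n..int n. of_int (alt k) * fps_X ^ pent k) +
      (of_int (alt (- int (Suc n))) * fps_X ^ pent (- int (Suc n)) + of_int (alt (int (Suc n))) * fps_X ^ pent (int (Suc n)))"
    by (simp add: add_ac)
  also have "of_int (alt (- int (Suc n))) * fps_X ^ pent (- int (Suc n)) + of_int (alt (int (Suc n))) * fps_X ^ pent (int (Suc n)) =
     (- 1) ^ Suc n * (fps_X ^ (Suc n * Suc n + Suc n * (Suc n + 1) div 2) + fps_X ^ (Suc n * Suc n + n * (n + 1) div 2) :: int fps)"
    unfolding alt_of_nat pent_of_nat pent_minus_of_nat by (simp only: distrib_left) simp
  finally show ?case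
    unfolding Suc.IH[symmetric] by (simp only: shanks_telescope)
qed

text \<open>Modulo q^(n+1) only the summand \<open>j = 0\<close> of the Shanks sum survives, and it
  is \<open>euler_partial n\<close>. The other side of \<open>pentagonal_partial\<close> is a
  truncation of the full signed series.\<close>

lemma euler_pentagonal: "euler = theta UNIV"
proof (rule agree_all_imp_eq)
  fix n
  let ?F = "\<lambda>j. (- 1) ^ j * (\<Prod>i = Suc j..n. 1 - fps_X ^ i) * fps_X ^ (j * n + j * (j + 1) div 2) :: int fps"
  have "agree n (\<Sum>j\<le>n. ?F j) (euler_partial n)"
    unfolding agree_def
  proof (intro allI impI)
    fix i assume "i \<le> n"
    have "fps_nth (?F j) i = 0" if "j \<noteq> 0" for j
    proof -
      \<comment> \<open>For \<open>j > 0\<close> the first part of the exponent is at least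
        \<open>n\<close> and the triangular number is at least 1, which pushes the term beyond
        degree \<open>n\<close>.\<close>
      have "j * n + j * (j + 1) div 2 \<ge> 1 * n + 1"
        using that by (cases j) (auto intro!: add_mono simp: less_eq_div_iff_mult_less_eq)
      then show ?thesis
        using \<open>i \<le> n\<close> by (simp only: fps_X_power_mult_right_nth) auto
    qed
    then have "(\<Sum>j\<le>n. fps_nth (?F j) i) = (\<Sum>j\<le>n. if j = 0 then fps_nth (?F 0) i else 0)"
      by (intro sum.cong) auto
    also have "?F 0 = euler_partial n"
      by (simp add: euler_partial_def prod.atLeast1_atMost_eq)
    finally show "fps_nth (\<Sum>j\<le>n. ?F j) i = fps_nth (euler_partial n) i"
      by (simp add: fps_sum_nth)
  qed
  then have "agree n (\<Sum>k = - int n..int n. of_int (alt k) * fps_X ^ pent k) euler"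
    unfolding pentagonal_partial using euler_partial_agree[of n n] agree_trans by blast
  moreover have "agree n (\<Sum>k = - int n..int n. of_int (alt k) * fps_X ^ pent k) (theta UNIV)"
    unfolding agree_def
  proof (intro allI impI)
    fix i assume "i \<le> n"
    have "fps_nth (\<Sum>k = - int n..int n. of_int (alt k) * fps_X ^ pent k) i =
        (\<Sum>k = - int n..int n. if pent k = i then alt k else 0)"
      by (auto simp: fps_sum_nth fps_of_int [symmetric] intro!: sum.cong)
    also have "\<dots> = (\<Sum>k\<in>{k. pent k = i}. alt k)"
    proof -
      have "k \<in> {- int n..int n}" if "pent k = i" for k
        using abs_le_pent[of k] that \<open>i \<le> n\<close> by auto
      then have "{k. pent k = i} = {- int n..int n} \<inter> {k. pent k = i}"
        by blast
      then have "(\<Sum>k\<in>{k. pent k = i}. alt k) = (\<Sum>k\<in>{- int n..int n} \<inter> {k. pent k = i}. alt k)"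
        by (rule arg_cong)
      then show ?thesis
        by (simp add: sum.inter_restrict)
    qed
    finally show "fps_nth (\<Sum>k = - int n..int n. of_int (alt k) * fps_X ^ pent k) i = fps_nth (theta UNIV) i"
      by (simp add: theta_nth)
  qed
  ultimately show "agree n euler (theta UNIV)"
    by (meson agree_sym agree_trans)
qed

section \<open>Dissection modulo 5\<close>

abbreviation pent2 :: "int \<times> int \<Rightarrow> nat" where
  "pent2 p \<equiv> pent (fst p) + pent (snd p)"

abbreviation alt2 :: "int \<times> int \<Rightarrow> int" where
  "alt2 p \<equiv> alt (fst p) * alt (snd p)"

definition theta2 :: "(int \<times> int) set \<Rightarrow> int fps" where
  "theta2 R = Abs_fps (\<lambda>N. \<Sum>p\<in>{p \<in> R. pent2 p = N}. alt2 p)"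

lemma theta2_nth: "fps_nth (theta2 R) N = (\<Sum>p\<in>{p \<in> R. pent2 p = N}. alt2 p)"
  by (simp add: theta2_def)

lemma finite_pent2_eq [simp]: "finite {p \<in> R. pent2 p = N}"
proof (rule finite_subset)
  show "{p \<in> R. pent2 p = N} \<subseteq> {- int N..int N} \<times> {- int N..int N}"
  proof
    fix p assume "p \<in> {p \<in> R. pent2 p = N}"
    then show "p \<in> {- int N..int N} \<times> {- int N..int N}"
      using abs_le_pent[of "fst p"] abs_le_pent[of "snd p"] by (auto simp: mem_Times_iff)
  qed
qed simp

lemma theta2_union:
  assumes "R \<inter> Q = {}"
  shows "theta2 (R \<union> Q) = theta2 R + theta2 Q"
proof (rule fps_ext)
  fix N
  have "{p \<in> R \<union> Q. pent2 p = N} = {p \<in> R. pent2 p = N} \<union> {p \<in> Q. pent2 p = N}"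
    by auto
  then show "fps_nth (theta2 (R \<union> Q)) N = fps_nth (theta2 R + theta2 Q) N"
    using assms unfolding theta2_nth fps_add_nth by (simp only:) (intro sum.union_disjoint, auto)
qed

lemma theta_mult: "theta S * theta T = theta2 (S \<times> T)"
proof (rule fps_ext)
  fix N
  let ?A = "\<lambda>i. {k \<in> S. pent k = i} \<times> {l \<in> T. pent l = N - i}"
  have "{p \<in> S \<times> T. pent2 p = N} = (\<Union>i\<in>{0..N}. ?A i)"
    by auto
  then have "fps_nth (theta2 (S \<times> T)) N = (\<Sum>p\<in>(\<Union>i\<in>{0..N}. ?A i). alt2 p)"
    by (simp add: theta2_nth)
  also have "\<dots> = (\<Sum>i = 0..N. \<Sum>p\<in>?A i. alt2 p)"
    by (rule sum.UNION_disjoint) auto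
  also have "\<dots> = fps_nth (theta S * theta T) N"
    by (simp add: fps_mult_nth theta_nth sum_product sum.cartesian_product case_prod_unfold)
  finally show "fps_nth (theta S * theta T) N = fps_nth (theta2 (S \<times> T)) N" ..
qed

abbreviation residue_class :: "int \<Rightarrow> int set" where
  "residue_class r \<equiv> {k. k mod 5 = r}"

text \<open>The indices are grouped by \<open>pent k mod 5\<close>: the classes 0 and 2 of
  \<open>k\<close> give exponents 0, the class 1 gives 1, and the classes 3 and 4 give 2.\<close>

definition A0 :: "int fps" where "A0 = theta (residue_class 0 \<union> residue_class 2)"
definition A1 :: "int fps" where "A1 = theta (residue_class 1)"
definition A2 :: "int fps" where "A2 = theta (residue_class 3 \<union> residue_class 4)"

lemma euler_dissection: "euler = A0 + A1 + A2"
proof -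
  have "UNIV = (residue_class 0 \<union> residue_class 2) \<union> residue_class 1 \<union> (residue_class 3 \<union> residue_class 4)"
    by (rule set_eqI; simp; presburger)
  then have "euler = theta ((residue_class 0 \<union> residue_class 2) \<union> residue_class 1 \<union> (residue_class 3 \<union> residue_class 4))"
    by (simp only: euler_pentagonal)
  also have "\<dots> = A0 + A1 + A2"
    unfolding A0_def A1_def A2_def by (subst theta_union; (subst theta_union)?; auto)
  finally show ?thesis .
qed

text \<open>Writing \<open>k = (x + 1) / 6\<close> and \<open>l = (y + 1) / 6\<close>, the quadratic form \<open>pent k + pent l\<close> becomes \<open>x\<^sup>2 + y\<^sup>2\<close> up
  to an affine change. On the sublattice \<open>y \<equiv> 2 x (mod 5)\<close>, that is, on the multiples of \<open>1 + 2 i\<close>, the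
  reflection \<open>(x, y) \<mapsto> ((3 x - 4 y) / 5, - (4 x + 3 y) / 5)\<close> is integral, and it reverses the sign.\<close>

lemma theta2_sublattice_eq_0: "theta2 {p. (snd p - 2 * fst p + 1) mod 5 = 0} = 0"
proof (rule fps_ext)
  fix N
  define R :: "(int \<times> int) set" where "R = {p. (snd p - 2 * fst p + 1) mod 5 = 0}"
  define s :: "int \<times> int \<Rightarrow> int" where "s = (\<lambda>p. (snd p - 2 * fst p + 1) div 5)"
  \<comment> \<open>The reflection in the coordinates \<open>k\<close> and \<open>s\<close>, where
    \<open>l = 2 k - 1 + 5 s\<close>: it fixes \<open>s\<close>, sends \<open>k\<close> to
    \<open>1 - 4 s - k\<close>, and determines the new \<open>l\<close> by the same
    relation.\<close>
  define \<psi> where "\<psi> = (\<lambda>p. (1 - 4 * s p - fst p, 2 * (1 - 4 * s p - fst p) - 1 + 5 * s p))"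
  have R: "snd p = 2 * fst p - 1 + 5 * s p" if "p \<in> R" for p
    using that by (auto simp: R_def s_def)
  have s_\<psi>: "s (\<psi> p) = s p" for p
    by (simp add: s_def \<psi>_def)
  have \<psi>_R: "\<psi> p \<in> R" for p
    by (simp add: \<psi>_def R_def)
  have \<psi>_\<psi>: "\<psi> (\<psi> p) = p" if "p \<in> R" for p
    using R[OF that] s_\<psi>[of p] by (simp add: \<psi>_def prod_eq_iff)
  have pent: "pent2 (\<psi> p) = pent2 p" if "p \<in> R" for p
  proof -
    have "2 * int (pent2 (\<psi> p)) = 2 * int (pent2 p)"
      unfolding of_nat_add distrib_left pent_double R[OF that]
      by (simp add: \<psi>_def algebra_simps)
    then show ?thesis
      by (simp only: mult_cancel_left of_nat_eq_iff) simp
  qed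
  \<comment> \<open>The old and new indices add up to \<open>1 - 2 s\<close>, which is odd, so
    exactly one of the two pairs has an even sum.\<close>
  have alt: "alt2 (\<psi> p) = - alt2 p" if "p \<in> R" for p
    unfolding R[OF that] by (auto simp: \<psi>_def alt_def)
  have "(\<Sum>p\<in>{p \<in> R. pent2 p = N}. alt2 p) = (\<Sum>p\<in>{p \<in> R. pent2 p = N}. - alt2 p)"
    by (rule sum.reindex_bij_witness[of _ \<psi> \<psi>]) (auto simp: \<psi>_R \<psi>_\<psi> pent alt)
  then have "(\<Sum>p\<in>{p \<in> R. pent2 p = N}. alt2 p) = 0"
    by (simp add: sum_negf)
  then show "fps_nth (theta2 {p. (snd p - 2 * fst p + 1) mod 5 = 0}) N = fps_nth 0 N"
    by (simp add: theta2_nth R_def)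
qed

text \<open>The sublattice with vanishing series splits into five products of residue classes. Four
  of them contribute the terms of \<open>A0 * A2\<close>, and the pair of classes (1, 1) contributes
  the square of \<open>A1\<close>.\<close>

lemma A0_A2: "A0 * A2 = - A1\<^sup>2"
proof -
  let ?B = "\<lambda>r. theta (residue_class r)"
  have A0: "A0 = ?B 0 + ?B 2" and A2: "A2 = ?B 3 + ?B 4"
    unfolding A0_def A2_def by (subst theta_union; auto)+
  let ?Q = "\<lambda>r s. residue_class r \<times> residue_class s"
  have "{p. (snd p - 2 * fst p + 1) mod 5 = 0} = ?Q 0 4 \<union> ?Q 2 3 \<union> ?Q 3 0 \<union> ?Q 4 2 \<union> ?Q 1 1"
  proof (rule set_eqI)
    fix p :: "int \<times> int"
    have "(l - 2 * k + 1) mod 5 = 0 \<longleftrightarrow> k mod 5 = 0 \<and> l mod 5 = 4 \<or> k mod 5 = 2 \<and> l mod 5 = 3 \<or>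
       k mod 5 = 3 \<and> l mod 5 = 0 \<or> k mod 5 = 4 \<and> l mod 5 = 2 \<or> k mod 5 = 1 \<and> l mod 5 = 1" for k l :: int
    proof -
      have "[l - 2 * k + 1 = l mod 5 - 2 * (k mod 5) + 1] (mod 5)"
        by (intro cong_add cong_diff cong_mult cong_refl) (simp_all add: cong_def)
      moreover have "k mod 5 \<in> {0, 1, 2, 3, 4}" "l mod 5 \<in> {0, 1, 2, 3, 4}"
        by auto
      ultimately show ?thesis
        unfolding cong_def by (elim insertE emptyE) simp_all
    qed
    then show "p \<in> {p. (snd p - 2 * fst p + 1) mod 5 = 0} \<longleftrightarrow>
        p \<in> ?Q 0 4 \<union> ?Q 2 3 \<union> ?Q 3 0 \<union> ?Q 4 2 \<union> ?Q 1 1"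
      by (auto simp: mem_Times_iff)
  qed
  moreover have "theta2 (?Q 0 4 \<union> ?Q 2 3 \<union> ?Q 3 0 \<union> ?Q 4 2 \<union> ?Q 1 1) =
      ?B 0 * ?B 4 + ?B 2 * ?B 3 + ?B 3 * ?B 0 + ?B 4 * ?B 2 + ?B 1 * ?B 1"
  proof -
    have "?Q r s \<inter> ?Q r' s' = {}" if "r \<noteq> r'" for r s r' s'
      using that by auto
    then show ?thesis
      unfolding theta_mult by (simp add: theta2_union Int_Un_distrib2)
  qed
  ultimately have "?B 0 * ?B 4 + ?B 2 * ?B 3 + ?B 3 * ?B 0 + ?B 4 * ?B 2 + ?B 1 * ?B 1 = 0"
    using theta2_sublattice_eq_0 by simp
  then have "A0 * A2 + A1\<^sup>2 = 0"
    unfolding A0 A2 A1_def by (simp add: algebra_simps power2_eq_square)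
  then show ?thesis
    by (simp add: eq_neg_iff_add_eq_0)
qed

text \<open>Substitute \<open>k = 1 - 5 j\<close>: then \<open>pent k = 1 + 25 * pent j\<close>, and
  the sign flips because \<open>k\<close> and \<open>j\<close> have opposite parity.\<close>

lemma A1_eq: "A1 = - fps_X * (euler oo fps_X ^ 25)"
proof (rule fps_ext)
  fix N
  have pent: "pent (1 - 5 * j) = Suc (25 * pent j)" for j
  proof -
    have "2 * int (pent (1 - 5 * j)) = 2 * int (Suc (25 * pent j))"
      using pent_double[of j] pent_double[of "1 - 5 * j"] by (simp add: algebra_simps)
    then show ?thesis
      by (simp only: mult_cancel_left of_nat_eq_iff) simp
  qed
  have surj: "k = 1 - 5 * ((1 - k) div 5)" if "k mod 5 = 1" for k :: int
    using that by presburger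
  have "(\<Sum>k\<in>{k \<in> residue_class 1. pent k = N}. alt k) =
    (\<Sum>j\<in>{j. Suc (25 * pent j) = N}. - alt j)"
  proof (rule sum.reindex_bij_witness[of _ "\<lambda>j. 1 - 5 * j" "\<lambda>k. (1 - k) div 5"])
    fix k assume k: "k \<in> {k \<in> residue_class 1. pent k = N}"
    then obtain j where j: "k = 1 - 5 * j"
      using surj by blast
    show "1 - 5 * ((1 - k) div 5) = k" "(1 - k) div 5 \<in> {j. Suc (25 * pent j) = N}"
      "- alt ((1 - k) div 5) = alt k"
      using k by (auto simp: j pent alt_def)
  next
    fix j
    have "(1 - 5 * j) mod 5 = (1 :: int)"
      by presburger
    moreover assume "j \<in> {j. Suc (25 * pent j) = N}"
    ultimately show "1 - 5 * j \<in> {k \<in> residue_class 1. pent k = N}"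
      by (simp only: mem_Collect_eq pent simp_thms)
    show "(1 - (1 - 5 * j)) div 5 = j"
      by simp
  qed
  also have "\<dots> = fps_nth (- fps_X * (euler oo fps_X ^ 25)) N"
  proof (cases N)
    case (Suc M)
    have "{j. Suc (25 * pent j) = N} = (if 25 dvd M then {j. pent j = M div 25} else {})"
      by (auto simp: Suc)
    then show ?thesis
      by (simp add: Suc fps_nth_compose_X_power euler_pentagonal theta_nth sum_negf)
  qed simp
  finally show "fps_nth A1 N = fps_nth (- fps_X * (euler oo fps_X ^ 25)) N"
    by (simp add: A1_def theta_nth)
qed

section \<open>The product over the fifth roots of unity\<close>

definition supported :: "nat \<Rightarrow> nat \<Rightarrow> 'a::zero fps \<Rightarrow> bool" where
  "supported m r f \<longleftrightarrow> (\<forall>n. fps_nth f n \<noteq> 0 \<longrightarrow> n mod m = r mod m)"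

lemma supported_theta:
  assumes "\<And>k. k \<in> S \<Longrightarrow> pent k mod m = r mod m"
  shows "supported m r (theta S)"
  unfolding supported_def theta_nth
proof (intro allI impI)
  fix n assume "(\<Sum>k\<in>{k \<in> S. pent k = n}. alt k) \<noteq> 0"
  then obtain k where "k \<in> {k \<in> S. pent k = n}"
    by (meson sum.not_neutral_contains_not_neutral)
  then show "n mod m = r mod m"
    using assms by auto
qed

text \<open>Halving modulo 5 is multiplication by 3.\<close>

lemma pent_mod_5: "int (pent k) mod 5 = 3 * (k * (3 * k - 1)) mod 5"
proof -
  have "3 * (k * (3 * k - 1)) = int (pent k) + 5 * int (pent k)"
    using pent_double[of k] by simp
  then show ?thesis
    by (simp only: mod_mult_self2)
qed

lemma supported_A0: "supported 5 0 A0"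
  and supported_A1: "supported 5 1 A1"
  and supported_A2: "supported 5 2 A2"
proof -
  have *: "pent k mod 5 = r mod 5" if "k mod 5 = c" "3 * (c * (3 * c - 1)) mod 5 = int r mod 5" for k c r
  proof -
    have "[k = c] (mod 5)"
      using that(1) by (auto simp: cong_def)
    then have "[3 * (k * (3 * k - 1)) = 3 * (c * (3 * c - 1))] (mod 5)"
      by (intro cong_mult cong_diff cong_refl)
    then have "int (pent k) mod 5 = int r mod 5"
      unfolding pent_mod_5 using that(2) by (simp only: cong_def)
    then have "int (pent k mod 5) = int (r mod 5)"
      by (simp only: of_nat_mod of_nat_numeral)
    then show ?thesis
      by (simp only: of_nat_eq_iff)
  qed
  show "supported 5 0 A0" unfolding A0_def
    by (rule supported_theta) (use *[of _ 0 0] *[of _ 2 0] in auto)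
  show "supported 5 1 A1" unfolding A1_def
    by (rule supported_theta) (use *[of _ 1 1] in auto)
  show "supported 5 2 A2" unfolding A2_def
    by (rule supported_theta) (use *[of _ 3 2] *[of _ 4 2] in auto)
qed

section \<open>Rotations of the variable by fifth roots of unity\<close>

definition zeta5 :: complex where
  "zeta5 = cis (2 * pi / 5)"

lemma zeta5_power_5: "zeta5 ^ 5 = 1"
proof -
  have "real 5 * (2 * pi / 5) = 2 * pi"
    by simp
  then show ?thesis
    unfolding zeta5_def Complex.DeMoivre by (simp only: cis_2pi)
qed

lemma zeta5_cyclotomic: "1 + zeta5 + zeta5 ^ 2 + zeta5 ^ 3 + zeta5 ^ 4 = 0"
proof -
  have "zeta5 \<noteq> 1"
  proof
    assume "zeta5 = 1"
    then have "cos (2 * pi / 5) = 1"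
      by (simp add: zeta5_def complex_eq_iff)
    moreover have "cos (2 * pi / 5) < cos 0"
      by (rule cos_monotone_0_pi) (auto simp: field_simps)
    ultimately show False
      by simp
  qed
  moreover have "(zeta5 - 1) * (1 + zeta5 + zeta5 ^ 2 + zeta5 ^ 3 + zeta5 ^ 4) = zeta5 ^ 5 - 1"
    by (simp add: algebra_simps power_numeral_reduce)
  ultimately show ?thesis
    by (simp add: zeta5_power_5)
qed

definition rot :: "nat \<Rightarrow> int fps \<Rightarrow> complex fps" where
  "rot i f = int_fps f oo (fps_const (zeta5 ^ i) * fps_X)"

lemma rot_nth: "fps_nth (rot i f) n = zeta5 ^ (i * n) * of_int (fps_nth f n)"
  by (simp add: rot_def power_mult)

lemma rot_1 [simp]: "rot i 1 = 1"
  by (simp add: rot_def)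

lemma rot_add: "rot i (f + g) = rot i f + rot i g"
  by (simp add: rot_def fps_compose_add_distrib)

lemma rot_mult: "rot i (f * g) = rot i f * rot i g"
  by (simp add: rot_def fps_compose_mult_distrib)

lemma rot_one_minus_X_power: "rot i (1 - fps_X ^ m) = 1 - fps_const (zeta5 ^ m) ^ i * fps_X ^ m"
  by (rule fps_ext) (auto simp: rot_nth fps_const_power power_mult[symmetric] mult.commute)

lemma zeta5_power_mod: "zeta5 ^ m = zeta5 ^ (m mod 5)"
  by (metis zeta5_power_5 mult_div_mod_eq power_add power_mult power_one mult_1)

text \<open>The substitution multiplies the coefficient of q^n by a root of unity that depends only
  on \<open>n mod 5\<close>, hence acts as a scalar on a series supported on one class.\<close>

lemma rot_supported:
  assumes "supported 5 r f"
  shows "rot i f = fps_const zeta5 ^ (i * r) * int_fps f"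
proof (rule fps_ext)
  fix n
  show "fps_nth (rot i f) n = fps_nth (fps_const zeta5 ^ (i * r) * int_fps f) n"
  proof (cases "fps_nth f n = 0")
    case False
    then have "n mod 5 = r mod 5"
      using assms by (simp add: supported_def)
    then have "(i * n) mod 5 = (i * r) mod 5"
      by (metis mod_mult_right_eq)
    then show ?thesis
      by (metis fps_const_power fps_mult_left_const_nth int_fps_nth rot_nth zeta5_power_mod)
  qed (simp add: rot_nth fps_const_power)
qed

definition norm5 :: "int fps \<Rightarrow> complex fps" where
  "norm5 f = rot 0 f * rot 1 f * rot 2 f * rot 3 f * rot 4 f"

lemma norm5_1 [simp]: "norm5 1 = 1"
  by (simp add: norm5_def)

lemma norm5_mult: "norm5 (f * g) = norm5 f * norm5 g"
  by (simp add: norm5_def rot_mult mult_ac)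

lemma norm5_agree:
  assumes "agree n f g"
  shows "agree n (norm5 f) (norm5 g)"
proof -
  have "agree n (rot i f) (rot i g)" for i
    using assms by (simp add: agree_def rot_nth)
  then show ?thesis
    unfolding norm5_def by (intro agree_mult)
qed

lemma cyclotomic_product:
  fixes w y :: "'a::idom"
  assumes "1 + w + w ^ 2 + w ^ 3 + w ^ 4 = 0"
  shows "(1 - y) * (1 - w * y) * (1 - w ^ 2 * y) * (1 - w ^ 3 * y) * (1 - w ^ 4 * y) = 1 - y ^ 5"
  using assms by algebra

text \<open>If 5 divides \<open>m\<close>, every rotation fixes the factor. Otherwise
  \<open>zeta5 ^ m\<close> is again a primitive fifth root of unity, and the five conjugates
  multiply to \<open>1 - q^(5 m)\<close>.\<close>

lemma norm5_one_minus_X_power: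
  "norm5 (1 - fps_X ^ m) = (if 5 dvd m then (1 - fps_X ^ m) ^ 5 else 1 - fps_X ^ (5 * m))"
proof (cases "5 dvd m")
  case True
  then have "zeta5 ^ m = 1"
    by (subst zeta5_power_mod) auto
  then show ?thesis
    using True by (simp add: norm5_def rot_one_minus_X_power power_numeral_reduce)
next
  case False
  define w where "w = zeta5 ^ (m mod 5)"
  have "m mod 5 = 1 \<or> m mod 5 = 2 \<or> m mod 5 = 3 \<or> m mod 5 = 4"
    using False by presburger
  moreover have w_power: "w ^ k = zeta5 ^ ((m mod 5) * k mod 5)" for k
    unfolding w_def by (metis power_mult zeta5_power_mod)
  \<comment> \<open>The powers of \<open>w\<close> permute those of \<open>zeta5\<close>, so the
    cyclotomic relation carries over.\<close>
  ultimately have "1 + w ^ 1 + w ^ 2 + w ^ 3 + w ^ 4 = 0"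
    using zeta5_cyclotomic unfolding w_power by (elim disjE) (simp_all add: add_ac power2_eq_square)
  then have "1 + w + w ^ 2 + w ^ 3 + w ^ 4 = 0"
    by simp
  then have "1 + fps_const w + fps_const w ^ 2 + fps_const w ^ 3 + fps_const w ^ 4 = 0"
    by (metis fps_const_power fps_const_add fps_const_1_eq_1 fps_const_0_eq_0)
  from cyclotomic_product[OF this, of "fps_X ^ m"] show ?thesis
    using False unfolding norm5_def rot_one_minus_X_power zeta5_power_mod[of m] w_def[symmetric]
    by (simp add: mult.commute flip: power_mult)
qed

text \<open>Induction over blocks of five factors. The four exponents prime to 5 give
  \<open>1 - q^(5 m)\<close> and the fifth gives a fifth power; the extra factor on the left
  supplies the missing \<open>1 - q^(25 (L+1))\<close>, avoiding a quotient.\<close>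

lemma norm5_euler_partial:
  "norm5 (euler_partial (5 * L)) * int_fps (euler_partial L oo fps_X ^ 25) =
    int_fps ((euler_partial (5 * L) oo fps_X ^ 5) * (euler_partial L oo fps_X ^ 5) ^ 5)"
proof (induction L)
  case 0
  then show ?case
    by (simp add: euler_partial_def)
next
  case (Suc L)
  define Q :: "int fps" where "Q = (1 - fps_X ^ (5 * L + 1)) * (1 - fps_X ^ (5 * L + 2)) *
    (1 - fps_X ^ (5 * L + 3)) * (1 - fps_X ^ (5 * L + 4)) * (1 - fps_X ^ (5 * L + 5))"
  have EQ: "euler_partial (5 * Suc L) = euler_partial (5 * L) * Q"
    unfolding Q_def by (simp add: euler_partial_Suc eval_nat_numeral mult.assoc)
  have X: "(1 - fps_X ^ k) oo fps_X ^ d = (1 - fps_X ^ (d * k) :: int fps)" if "d > 0" for k d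
    using that by (simp add: fps_compose_sub_distrib power_mult flip: fps_compose_power)
  have ES: "euler_partial (Suc L) oo fps_X ^ d = (euler_partial L oo fps_X ^ d) * (1 - fps_X ^ (d * Suc L))"
    if "d > 0" for d
  proof -
    have "fps_nth (fps_X ^ d :: int fps) 0 = 0"
      using that by simp
    then show ?thesis
      by (simp only: euler_partial_Suc fps_compose_mult_distrib X[OF that])
  qed
  have NQ: "norm5 Q * int_fps (1 - fps_X ^ (25 * Suc L)) =
      int_fps ((Q oo fps_X ^ 5) * (1 - fps_X ^ (5 * Suc L)) ^ 5)"
  proof -
    have *: "norm5 (1 - fps_X ^ (5 * L + r)) = 1 - fps_X ^ (5 * (5 * L + r))" if "r \<in> {1, 2, 3, 4}" for r
    proof -
      have "\<not> 5 dvd 5 * L + r"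
        unfolding dvd_eq_mod_eq_0 mod_mult_self4 using that by auto
      then show ?thesis
        by (simp only: norm5_one_minus_X_power if_False)
    qed
    have n: "norm5 (1 - fps_X ^ (5 * L + 1)) = 1 - fps_X ^ (5 * (5 * L + 1))"
      "norm5 (1 - fps_X ^ (5 * L + 2)) = 1 - fps_X ^ (5 * (5 * L + 2))"
      "norm5 (1 - fps_X ^ (5 * L + 3)) = 1 - fps_X ^ (5 * (5 * L + 3))"
      "norm5 (1 - fps_X ^ (5 * L + 4)) = 1 - fps_X ^ (5 * (5 * L + 4))"
      by (rule *, simp)+
    have **: "norm5 (1 - fps_X ^ (5 * L + 5)) = (1 - fps_X ^ (5 * L + 5)) ^ 5"
      unfolding norm5_one_minus_X_power by simp
    have Q5: "Q oo fps_X ^ 5 = (1 - fps_X ^ (5 * (5 * L + 1))) * (1 - fps_X ^ (5 * (5 * L + 2))) *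
        (1 - fps_X ^ (5 * (5 * L + 3))) * (1 - fps_X ^ (5 * (5 * L + 4))) * (1 - fps_X ^ (5 * (5 * L + 5)))"
    proof -
      have "fps_nth (fps_X ^ 5 :: int fps) 0 = 0"
        by simp
      then show ?thesis
        unfolding Q_def by (simp only: fps_compose_mult_distrib X[of 5] zero_less_numeral)
    qed
    have e: "5 * Suc L = 5 * L + 5" "25 * Suc L = 5 * (5 * L + 5)"
      by simp_all
    show ?thesis
      unfolding Q5 e unfolding Q_def norm5_mult ** n
      by (simp only: int_fps_mult int_fps_power int_fps_minus int_fps_1 int_fps_X mult_ac)
  qed
  have Q5: "(euler_partial (5 * L) * Q) oo fps_X ^ 5 = (euler_partial (5 * L) oo fps_X ^ 5) * (Q oo fps_X ^ 5)"
    by (simp add: fps_compose_mult_distrib)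
  have "norm5 (euler_partial (5 * Suc L)) * int_fps (euler_partial (Suc L) oo fps_X ^ 25) =
      (norm5 (euler_partial (5 * L)) * int_fps (euler_partial L oo fps_X ^ 25)) *
      (norm5 Q * int_fps (1 - fps_X ^ (25 * Suc L)))"
    unfolding EQ norm5_mult ES[OF zero_less_numeral] int_fps_mult by (simp only: mult_ac)
  also have "\<dots> = int_fps ((euler_partial (5 * L) oo fps_X ^ 5) * (euler_partial L oo fps_X ^ 5) ^ 5) *
      int_fps ((Q oo fps_X ^ 5) * (1 - fps_X ^ (5 * Suc L)) ^ 5)"
    by (simp only: Suc.IH NQ)
  also have "\<dots> = int_fps ((euler_partial (5 * Suc L) oo fps_X ^ 5) * (euler_partial (Suc L) oo fps_X ^ 5) ^ 5)"
    unfolding EQ Q5 ES[OF zero_less_numeral] int_fps_mult int_fps_power power_mult_distrib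
    by (simp only: mult_ac)
  finally show ?case .
qed

lemma norm5_euler:
  "norm5 euler * int_fps (euler oo fps_X ^ 25) = int_fps ((euler oo fps_X ^ 5) ^ 6)"
proof (rule agree_all_imp_eq)
  fix n
  have "agree n (norm5 (euler_partial (5 * n)) * int_fps (euler_partial n oo fps_X ^ 25))
     (norm5 euler * int_fps (euler oo fps_X ^ 25))"
    by (intro agree_mult norm5_agree int_fps_agree agree_compose_X_power euler_partial_agree) auto
  moreover have "agree n (int_fps ((euler_partial (5 * n) oo fps_X ^ 5) * (euler_partial n oo fps_X ^ 5) ^ 5) :: complex fps)
     (int_fps ((euler oo fps_X ^ 5) * (euler oo fps_X ^ 5) ^ 5))"
    by (intro agree_mult agree_power int_fps_agree agree_compose_X_power euler_partial_agree) auto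
  moreover have "(euler oo fps_X ^ 5) ^ 6 = (euler oo fps_X ^ 5) * (euler oo fps_X ^ 5) ^ 5"
    by (simp add: eval_nat_numeral)
  ultimately show "agree n (norm5 euler * int_fps (euler oo fps_X ^ 25)) (int_fps ((euler oo fps_X ^ 5) ^ 6))"
    unfolding norm5_euler_partial by (metis agree_sym agree_trans)
qed

text \<open>Pair \<open>w\<close> with \<open>w ^ 4\<close> and \<open>w ^ 2\<close> with
  \<open>w ^ 3\<close>. The two products are conjugate over the quadratic subfield, so their product
  is rational in \<open>S\<close>, \<open>T\<close>, \<open>U\<close>; the relation between
  \<open>a\<close>, \<open>b\<close>, \<open>c\<close> then collapses it to three fifth
  powers.\<close>

lemma norm5_identity:
  fixes a b c w :: "'a::idom"
  assumes w: "1 + w + w ^ 2 + w ^ 3 + w ^ 4 = 0" and ac: "a * c = - b\<^sup>2"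
  shows "(a + b + c) * (a + w * b + w ^ 2 * c) * (a + w ^ 2 * b + w ^ 4 * c) *
    (a + w ^ 3 * b + w ^ 6 * c) * (a + w ^ 4 * b + w ^ 8 * c) = a ^ 5 + 11 * b ^ 5 + c ^ 5"
proof -
  \<comment> \<open>\<open>p\<close> and \<open>q\<close> are the two quadratic periods, with sum
    and product \<open>- 1\<close>; exchanging them exchanges the two paired products.\<close>
  define p q S T U where "p = w + w ^ 4" and "q = w ^ 2 + w ^ 3"
    and "S = a\<^sup>2 + b\<^sup>2 + c\<^sup>2" and "T = a * b + b * c" and "U = a * c"
  have 1: "(a + w * b + w ^ 2 * c) * (a + w ^ 4 * b + w ^ 8 * c) = S + p * T + q * U"
    using w unfolding p_def q_def S_def T_def U_def by algebra
  have 2: "(a + w ^ 2 * b + w ^ 4 * c) * (a + w ^ 3 * b + w ^ 6 * c) = S + q * T + p * U"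
    using w unfolding p_def q_def S_def T_def U_def by algebra
  have "p + q = - 1" "p * q = - 1"
    using w unfolding p_def q_def by algebra+
  then have 3: "(S + p * T + q * U) * (S + q * T + p * U) = S\<^sup>2 - S * (T + U) - T\<^sup>2 - U\<^sup>2 + 3 * (T * U)"
    by algebra
  have 4: "(a + b + c) * (S\<^sup>2 - S * (T + U) - T\<^sup>2 - U\<^sup>2 + 3 * (T * U)) = a ^ 5 + 11 * b ^ 5 + c ^ 5"
    using ac unfolding S_def T_def U_def by algebra
  show ?thesis
    unfolding 4[symmetric] 3[symmetric] 1[symmetric] 2[symmetric] by (simp only: mult_ac)
qed

text \<open>An integral representative of \<open>norm5 euler\<close>, by
  \<open>norm5_identity\<close> applied to the dissection.\<close>

definition euler_norm :: "int fps" where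
  "euler_norm = A0 ^ 5 + 11 * A1 ^ 5 + A2 ^ 5"

text \<open>Compare two evaluations of \<open>norm5 euler\<close>, one from the product and one from
  the dissection. The embedding \<open>int_fps\<close> into complex series is injective, so the
  identity descends to the integers.\<close>

lemma euler_norm_eq: "euler_norm * (euler oo fps_X ^ 25) = (euler oo fps_X ^ 5) ^ 6"
proof -
  let ?w = "fps_const zeta5"
  have rot: "rot i euler = int_fps A0 + ?w ^ i * int_fps A1 + ?w ^ (i * 2) * int_fps A2" for i
    unfolding euler_dissection rot_add
    by (simp only: rot_supported[OF supported_A0] rot_supported[OF supported_A1] rot_supported[OF supported_A2]) simp
  have w: "1 + ?w + ?w ^ 2 + ?w ^ 3 + ?w ^ 4 = 0"
    using zeta5_cyclotomic by (metis fps_const_power fps_const_add fps_const_1_eq_1 fps_const_0_eq_0)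
  have "int_fps A0 * int_fps A2 = (int_fps (- A1\<^sup>2) :: complex fps)"
    by (simp only: A0_A2 flip: int_fps_mult)
  then have "int_fps A0 * int_fps A2 = (- (int_fps A1)\<^sup>2 :: complex fps)"
    by simp
  from norm5_identity[OF w this] have "norm5 euler = int_fps euler_norm"
    unfolding norm5_def rot euler_norm_def by simp
  with norm5_euler have "int_fps (euler_norm * (euler oo fps_X ^ 25)) = (int_fps ((euler oo fps_X ^ 5) ^ 6) :: complex fps)"
    by simp
  then show ?thesis
    by (simp add: fps_eq_iff del: int_fps_mult int_fps_power)
qed

section \<open>Residue classes of powers of the Euler product\<close>

definition fcong :: "int \<Rightarrow> int fps \<Rightarrow> int fps \<Rightarrow> bool" where
  "fcong m f g \<longleftrightarrow> fps_const m dvd f - g"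

lemma fcong_iff: "fcong m f g \<longleftrightarrow> (\<forall>n. m dvd fps_nth f n - fps_nth g n)"
proof
  assume "\<forall>n. m dvd fps_nth f n - fps_nth g n"
  then have "f - g = fps_const m * Abs_fps (\<lambda>n. (fps_nth f n - fps_nth g n) div m)"
    by (intro fps_ext) simp
  then show "fcong m f g"
    unfolding fcong_def by (rule dvdI)
qed (auto simp: fcong_def dvd_def fps_eq_iff)

lemma fcong_refl [simp]: "fcong m f f"
  by (simp add: fcong_def)

lemma fcong_sym: "fcong m f g \<Longrightarrow> fcong m g f"
  unfolding fcong_iff by (simp add: dvd_diff_commute)

lemma fcong_trans [trans]: "fcong m f g \<Longrightarrow> fcong m g h \<Longrightarrow> fcong m f h"
  unfolding fcong_def using dvd_add[of "fps_const m" "f - g" "g - h"] by simp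

lemma fcong_eq_trans [trans]: "fcong m f g \<Longrightarrow> g = h \<Longrightarrow> fcong m f h"
  "f = g \<Longrightarrow> fcong m g h \<Longrightarrow> fcong m f h"
  by simp_all

lemma fcong_mult:
  assumes "fcong m f g" "fcong m h k"
  shows "fcong m (f * h) (g * k)"
proof -
  have "f * h - g * k = (f - g) * h + g * (h - k)"
    by (simp add: algebra_simps)
  then show ?thesis
    using assms by (simp add: fcong_def)
qed

lemma fcong_power: "fcong m f g \<Longrightarrow> fcong m (f ^ n) (g ^ n)"
  by (induction n) (auto intro: fcong_mult)

lemma fcong_modulus_dvd: "fcong m f g \<Longrightarrow> l dvd m \<Longrightarrow> fcong l f g"
  unfolding fcong_iff by (meson dvd_trans)

lemma fcong_scale: "fcong m f g \<Longrightarrow> fcong (c * m) (fps_const c * f) (fps_const c * g)"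
  unfolding fcong_iff by (simp flip: right_diff_distrib)

lemma fcong_multipleI: "f = g + fps_const m * h \<Longrightarrow> fcong m f g"
  by (simp add: fcong_def)

text \<open>With \<open>f = g + m h\<close>, the linear term of the expansion carries
  \<open>5 m\<close>, and every later term carries \<open>m ^ 2\<close>, a multiple of
  \<open>5 m\<close> because 5 divides \<open>m\<close>. Iteration gives the powers 25, 125 and
  625.\<close>

lemma fcong_power_5:
  assumes "fcong m f g" "5 dvd m"
  shows "fcong (5 * m) (f ^ 5) (g ^ 5)"
proof -
  from assms(1) obtain h where "f - g = fps_const m * h"
    unfolding fcong_def by (rule dvdE)
  then have f: "f = g + fps_const m * h"
    by (simp add: algebra_simps)
  obtain l where m: "m = 5 * l"
    using assms(2) by (rule dvdE)
  define c :: "int fps" where "c = fps_const l"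
  have c: "fps_const m = 5 * c" "fps_const (5 * m) = 25 * c"
    unfolding c_def m by (simp_all add: fps_eq_iff fps_numeral_nth numeral_fps_const)
  have "f ^ 5 - g ^ 5 = 25 * c * (g ^ 4 * h + 10 * c * g ^ 3 * h ^ 2 + 50 * c ^ 2 * g ^ 2 * h ^ 3
    + 125 * c ^ 3 * g * h ^ 4 + 125 * c ^ 4 * h ^ 5)"
    unfolding f c by algebra
  then show ?thesis
    unfolding fcong_def c by simp
qed

abbreviation dilate :: "int fps \<Rightarrow> int fps" where
  "dilate f \<equiv> f oo fps_X ^ 5"

lemma dilate_mult: "dilate (f * g) = dilate f * dilate g"
  by (simp add: fps_compose_mult_distrib)

lemma dilate_power: "dilate (f ^ n) = dilate f ^ n"
  by (simp add: fps_compose_power)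

lemma dilate_dilate_euler: "euler oo fps_X ^ 25 = dilate (dilate euler)"
  by (rule fps_ext) (auto simp: fps_nth_compose_X_power div_mult2_eq[symmetric] dvd_div_iff_mult elim!: dvd_trans[rotated])

text \<open>The Frobenius congruence \<open>(1 - y)^5 = 1 - y^5\<close> modulo 5, applied to each
  factor of a finite product and then passed to the limit degree by degree.\<close>

lemma fcong_euler_power_5: "fcong 5 (euler ^ 5) (dilate euler)"
proof -
  have partial: "fcong 5 (euler_partial n ^ 5) (dilate (euler_partial n))" for n
  proof (induction n)
    case (Suc n)
    define y :: "int fps" where "y = fps_X ^ Suc n"
    have "(1 - y) ^ 5 = (1 - y ^ 5) + fps_const 5 * (- y + 2 * y ^ 2 - 2 * y ^ 3 + y ^ 4)"
      unfolding numeral_fps_const[symmetric] by algebra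
    then have "fcong 5 ((1 - y) ^ 5) (1 - y ^ 5)"
      by (rule fcong_multipleI)
    also have "1 - y ^ 5 = dilate (1 - y)"
    proof -
      have "dilate y = (fps_X ^ 5) ^ Suc n"
        unfolding y_def by (rule fps_X_power_compose) simp
      then show ?thesis
        by (simp only: y_def fps_compose_sub_distrib fps_compose_1 mult.commute flip: power_mult)
    qed
    finally show ?case
      unfolding euler_partial_Suc y_def[symmetric] power_mult_distrib dilate_mult by (intro fcong_mult Suc)
  qed (simp add: euler_partial_def)
  show ?thesis
    unfolding fcong_iff
  proof
    fix n
    have "agree n (euler_partial n ^ 5) (euler ^ 5)" "agree n (dilate (euler_partial n)) (dilate euler)"
      by (intro agree_power agree_compose_X_power euler_partial_agree order_refl)+
    then show "5 dvd fps_nth (euler ^ 5) n - fps_nth (dilate euler) n"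
      using partial[of n] unfolding fcong_iff agree_def by (metis order_refl)
  qed
qed

lemma fcong_euler_power_25: "fcong 25 (euler ^ 25) (dilate euler ^ 5)"
  using fcong_power_5[OF fcong_euler_power_5] by (simp flip: power_mult)

lemma fcong_euler_power_125: "fcong 125 (euler ^ 125) (dilate euler ^ 25)"
  using fcong_power_5[OF fcong_euler_power_25] by (simp flip: power_mult)

lemma fcong_euler_power_625: "fcong 625 (euler ^ 625) (dilate euler ^ 125)"
  using fcong_power_5[OF fcong_euler_power_125] by (simp flip: power_mult)

text \<open>The generating function of the partition numbers. The inverse exists over the integers
  because \<open>euler\<close> has constant coefficient 1, whose inverse is the second
  argument.\<close>

definition euler_inv :: "int fps" where
  "euler_inv = fps_right_inverse euler 1"

lemma euler_nth_0: "fps_nth euler 0 = 1"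
  by (simp add: euler_def euler_partial_def)

lemma euler_inv: "euler * euler_inv = 1"
  unfolding euler_inv_def by (rule fps_right_inverse) (simp add: euler_nth_0)

lemma dilate_euler_inv: "dilate euler * dilate euler_inv = 1"
  by (simp add: euler_inv flip: dilate_mult)

lemma fcong_euler_inv_power_5: "fcong 5 (euler_inv ^ 5) (dilate euler_inv)"
proof -
  have "fcong 5 (dilate euler_inv * euler_inv ^ 5 * euler ^ 5) (dilate euler_inv * euler_inv ^ 5 * dilate euler)"
    by (intro fcong_mult fcong_refl fcong_euler_power_5)
  moreover have "dilate euler_inv * euler_inv ^ 5 * euler ^ 5 = dilate euler_inv * (euler * euler_inv) ^ 5"
    by (simp only: power_mult_distrib mult_ac)
  moreover have "dilate euler_inv * euler_inv ^ 5 * dilate euler = euler_inv ^ 5 * (dilate euler * dilate euler_inv)"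
    by (simp only: mult_ac)
  ultimately show ?thesis
    by (simp add: euler_inv dilate_euler_inv fcong_sym)
qed

section \<open>Extraction of a residue class of exponents modulo 5\<close>

definition class_part :: "nat \<Rightarrow> int fps \<Rightarrow> int fps" where
  "class_part r f = Abs_fps (\<lambda>n. if n mod 5 = r mod 5 then fps_nth f n else 0)"

lemma class_part_nth: "fps_nth (class_part r f) n = (if n mod 5 = r mod 5 then fps_nth f n else 0)"
  by (simp add: class_part_def)

lemma class_part_add: "class_part r (f + g) = class_part r f + class_part r g"
  and class_part_minus: "class_part r (f - g) = class_part r f - class_part r g"
  by (rule fps_ext, simp add: class_part_nth)+

text \<open>Multiplication by a series in q^5 does not mix exponent classes, so extraction is linear
  over such series.\<close>

lemma class_part_mult:
  assumes "supported 5 0 g"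
  shows "class_part r (f * g) = class_part r f * g"
proof (rule fps_ext)
  fix n
  have "(i mod 5 = r mod 5) = (n mod 5 = r mod 5)" if "i \<le> n" "fps_nth g (n - i) \<noteq> 0" for i
  proof -
    have "(n - i) mod 5 = 0"
      using that assms by (simp add: supported_def)
    then show ?thesis
      using that(1) by (metis mod_eq_dvd_iff_nat dvd_eq_mod_eq_0)
  qed
  then have "(if n mod 5 = r mod 5 then fps_nth f i * fps_nth g (n - i) else 0) =
      (if i mod 5 = r mod 5 then fps_nth f i else 0) * fps_nth g (n - i)" if "i \<le> n" for i
    using that by (cases "fps_nth g (n - i) = 0") auto
  then have "(\<Sum>i = 0..n. if n mod 5 = r mod 5 then fps_nth f i * fps_nth g (n - i) else 0) =
      fps_nth (class_part r f * g) n"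
    unfolding fps_mult_nth class_part_nth by (intro sum.cong) auto
  then show "fps_nth (class_part r (f * g)) n = fps_nth (class_part r f * g) n"
    by (cases "n mod 5 = r mod 5") (simp_all add: class_part_nth fps_mult_nth)
qed

lemma supported_dilate: "supported 5 0 (dilate f)"
  by (simp add: supported_def fps_nth_compose_X_power dvd_eq_mod_eq_0)

lemma supported_numeral: "supported 5 0 (numeral k :: int fps)"
  by (simp add: supported_def fps_numeral_nth)

lemma class_part_mult_dilate: "class_part r (f * dilate g) = class_part r f * dilate g"
  by (rule class_part_mult) (rule supported_dilate)

lemma class_part_numeral_mult: "class_part r (numeral k * f) = numeral k * class_part r f"
  using class_part_mult[OF supported_numeral, of r f k] by (simp only: mult.commute)

lemma class_part_fcong: "fcong m f g \<Longrightarrow> fcong m (class_part r f) (class_part r g)"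
  by (simp add: fcong_iff class_part_nth)

lemma class_part_supported:
  "supported 5 s f \<Longrightarrow> class_part r f = (if s mod 5 = r mod 5 then f else 0)"
  by (rule fps_ext) (auto simp: class_part_nth supported_def)

lemma supported_mult:
  assumes "supported 5 r f" "supported 5 s (g :: int fps)"
  shows "supported 5 (r + s) (f * g)"
  unfolding supported_def
proof (intro allI impI)
  fix n assume "fps_nth (f * g) n \<noteq> 0"
  then obtain i where "i \<in> {0..n}" "fps_nth f i * fps_nth g (n - i) \<noteq> 0"
    unfolding fps_mult_nth by (meson sum.not_neutral_contains_not_neutral)
  then have "i \<le> n" "i mod 5 = r mod 5" "(n - i) mod 5 = s mod 5"
    using assms by (auto simp: supported_def)
  then have "(i + (n - i)) mod 5 = (r + s) mod 5"
    by (intro mod_add_cong)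
  then show "n mod 5 = (r + s) mod 5"
    using \<open>i \<le> n\<close> by simp
qed

lemma supported_1: "supported 5 0 (1 :: int fps)"
  by (simp add: supported_def)

lemma supported_power: "supported 5 r (f :: int fps) \<Longrightarrow> supported 5 (r * n) (f ^ n)"
  by (induction n) (auto simp: supported_1 add.commute intro: supported_mult)

text \<open>One descent step: the coefficient of \<open>f\<close> at \<open>5 n + r\<close> is
  traded for that of \<open>g\<close> at \<open>n\<close>.\<close>

lemma fcong_class_part_nth:
  assumes "fcong m (class_part r f) (fps_X ^ r * dilate g)" "r < 5"
  shows "m dvd fps_nth f (5 * n + r) - fps_nth g n"
proof -
  have "m dvd fps_nth (class_part r f) (5 * n + r) - fps_nth (fps_X ^ r * dilate g) (5 * n + r)"
    using assms(1) by (simp only: fcong_iff)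
  then show ?thesis
    using assms(2) by (simp add: class_part_nth fps_X_power_mult_nth fps_nth_compose_X_power)
qed

section \<open>Normal forms in \<open>A0\<close>, \<open>A1\<close>, \<open>A2\<close>\<close>

definition part_monom :: "nat \<Rightarrow> nat \<Rightarrow> nat \<Rightarrow> int fps" where
  "part_monom i j k = A0 ^ i * A1 ^ j * A2 ^ k"

lemma class_part_part_monom: "class_part r (part_monom i j k) = (if (j + 2 * k) mod 5 = r mod 5 then part_monom i j k else 0)"
proof (rule class_part_supported)
  have "supported 5 (0 * i + 1 * j + 2 * k) (part_monom i j k)"
    unfolding part_monom_def by (intro supported_mult supported_power supported_A0 supported_A1 supported_A2)
  then show "supported 5 (j + 2 * k) (part_monom i j k)"
    by simp
qed

text \<open>One fifth of \<open>euler ^ 5 - euler_norm\<close>, in normal form: the relation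
  \<open>A0_A2\<close> eliminates every monomial that contains both \<open>A0\<close> and
  \<open>A2\<close>. The class parts of the expansions are then read off monomial by
  monomial.\<close>

definition euler_mixed :: "int fps" where
  "euler_mixed = part_monom 4 1 0 + part_monom 3 2 0 - 2 * part_monom 2 3 0 - 3 * part_monom 1 4 0 - 3 * part_monom 0 4 1 - 2 * part_monom 0 3 2 + part_monom 0 2 3 + part_monom 0 1 4"

text \<open>The normal form of \<open>euler_norm\<close> divided by \<open>euler\<close>.\<close>

definition euler_cofactor :: "int fps" where
  "euler_cofactor = part_monom 4 0 0 - part_monom 3 1 0 + 2 * part_monom 2 2 0 - 3 * part_monom 1 3 0 + 5 * part_monom 0 4 0 - 3 * part_monom 0 3 1 + 2 * part_monom 0 2 2 - part_monom 0 1 3 + part_monom 0 0 4"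

lemma euler_power_4:
  "euler ^ 4 = part_monom 4 0 0 + 4 * part_monom 3 1 0 + 2 * part_monom 2 2 0 - 8 * part_monom 1 3 0 - 5 * part_monom 0 4 0 - 8 * part_monom 0 3 1 + 2 * part_monom 0 2 2 + 4 * part_monom 0 1 3 + part_monom 0 0 4"
  unfolding part_monom_def euler_dissection using A0_A2 by algebra

lemma euler_power_5: "euler ^ 5 = euler_norm + 5 * euler_mixed"
  unfolding euler_mixed_def euler_norm_def part_monom_def euler_dissection using A0_A2 by algebra

lemma euler_mult_euler_cofactor: "euler * euler_cofactor = euler_norm"
  unfolding euler_cofactor_def euler_norm_def part_monom_def euler_dissection using A0_A2 by algebra

lemma euler_mult_euler_mixed:
  "euler * euler_mixed = part_monom 5 1 0 + 2 * part_monom 4 2 0 - 2 * part_monom 3 3 0 - 6 * part_monom 2 4 0 - part_monom 1 5 0 + 6 * part_monom 0 6 0 - part_monom 0 5 1 - 6 * part_monom 0 4 2 - 2 * part_monom 0 3 3 + 2 * part_monom 0 2 4 + part_monom 0 1 5"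
  unfolding euler_mixed_def part_monom_def euler_dissection using A0_A2 by algebra

lemma euler_mixed_square:
  "euler_mixed ^ 2 = part_monom 8 2 0 + 2 * part_monom 7 3 0 - 3 * part_monom 6 4 0 - 10 * part_monom 5 5 0 - 2 * part_monom 4 6 0 + 18 * part_monom 3 7 0 + 11 * part_monom 2 8 0 - 18 * part_monom 1 9 0 - 10 * part_monom 0 10 0 - 18 * part_monom 0 9 1 + 11 * part_monom 0 8 2 + 18 * part_monom 0 7 3 - 2 * part_monom 0 6 4 - 10 * part_monom 0 5 5 - 3 * part_monom 0 4 6 + 2 * part_monom 0 3 7 + part_monom 0 2 8"
  unfolding euler_mixed_def part_monom_def using A0_A2 by algebra

lemmas class_part_simps = class_part_add class_part_minus class_part_numeral_mult class_part_part_monom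

lemma class_part_euler_power_4: "class_part 4 (euler ^ 4) = - 5 * A1 ^ 4"
  unfolding euler_power_4 class_part_simps by (simp add: part_monom_def)

lemma class_part_euler_mixed: "class_part 0 euler_mixed = 0"
  unfolding euler_mixed_def class_part_simps by simp

lemma class_part_euler_cofactor: "class_part 4 euler_cofactor = 5 * A1 ^ 4"
  unfolding euler_cofactor_def class_part_simps by (simp add: part_monom_def)

lemma class_part_euler_mult_euler_mixed: "class_part 1 (euler * euler_mixed) = A1 * euler_norm - 5 * A1 ^ 6"
  unfolding euler_mult_euler_mixed class_part_simps by (simp add: part_monom_def euler_norm_def algebra_simps power_numeral_reduce)

text \<open>The factor 10 matters: it supplies the last factor 5 needed for the quadratic term
  modulo 625 in \<open>class_part_euler_power_105\<close>.\<close>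

lemma class_part_euler_mixed_square: "class_part 0 (euler_mixed ^ 2) = - 10 * (part_monom 5 5 0 + part_monom 0 10 0 + part_monom 0 5 5)"
  unfolding euler_mixed_square class_part_simps by simp

lemma A1_dilate: "A1 = - (fps_X * dilate (dilate euler))"
  by (simp add: A1_eq dilate_dilate_euler)

lemma euler_norm_dilate: "euler_norm = dilate (euler ^ 6 * dilate euler_inv)"
proof -
  have "euler_norm = euler_norm * dilate (dilate euler) * dilate (dilate euler_inv)"
    by (simp add: mult.assoc euler_inv flip: dilate_mult)
  also have "\<dots> = dilate (euler ^ 6 * dilate euler_inv)"
    using euler_norm_eq by (simp add: dilate_dilate_euler dilate_mult dilate_power)
  finally show ?thesis .
qed

text \<open>Rationalising the denominator: 1/E is the cofactor divided by the norm, and the norm is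
  an invertible series in q^5.\<close>

lemma euler_inv_eq: "euler_inv = euler_cofactor * dilate (euler_inv ^ 6 * dilate euler)"
proof -
  have "(euler ^ 6 * dilate euler_inv) * (euler_inv ^ 6 * dilate euler) =
      (euler * euler_inv) ^ 6 * (dilate euler * dilate euler_inv)"
    by (simp only: power_mult_distrib mult_ac)
  also have "\<dots> = 1"
    by (simp only: euler_inv dilate_euler_inv power_one mult_1)
  finally have "euler_norm * dilate (euler_inv ^ 6 * dilate euler) = 1"
    unfolding euler_norm_dilate dilate_mult [symmetric] by simp
  then have "euler_inv = euler_inv * (euler * euler_cofactor * dilate (euler_inv ^ 6 * dilate euler))"
    by (simp add: euler_mult_euler_cofactor)
  also have "\<dots> = (euler * euler_inv) * (euler_cofactor * dilate (euler_inv ^ 6 * dilate euler))"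
    by (simp only: mult_ac)
  finally show ?thesis
    by (simp add: euler_inv)
qed

text \<open>Ramanujan's identity for the partition numbers \<open>p (5 n + 4)\<close>.\<close>

lemma class_part_euler_inv:
  "class_part 4 euler_inv = fps_X ^ 4 * dilate (5 * dilate euler ^ 5 * euler_inv ^ 6)"
proof -
  have "class_part 4 euler_inv = 5 * A1 ^ 4 * dilate (euler_inv ^ 6 * dilate euler)"
    by (subst euler_inv_eq) (simp only: class_part_mult_dilate class_part_euler_cofactor)
  also have "A1 ^ 4 = fps_X ^ 4 * dilate (dilate euler) ^ 4"
    by (simp add: A1_dilate power_mult_distrib)
  also have "5 * (fps_X ^ 4 * dilate (dilate euler) ^ 4) * dilate (euler_inv ^ 6 * dilate euler) =
      fps_X ^ 4 * dilate (5 * dilate euler ^ 5 * euler_inv ^ 6)"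
    unfolding dilate_mult dilate_power numeral_compose by (simp add: eval_nat_numeral mult_ac)
  finally show ?thesis .
qed

lemma dilate_nth_eq_0: "n mod 5 \<noteq> 0 \<Longrightarrow> fps_nth (dilate f) n = 0"
  by (auto simp: fps_nth_compose_X_power)

text \<open>Pentagonal numbers are 0, 1 or 2 modulo 5, and a factor in q^5 preserves the
  classes.\<close>

lemma euler_mult_dilate_nth_eq_0:
  assumes "n mod 5 = 3 \<or> n mod 5 = 4"
  shows "fps_nth (euler * dilate f) n = 0"
proof -
  have "class_part n euler = 0"
    unfolding euler_dissection class_part_add class_part_supported[OF supported_A0]
      class_part_supported[OF supported_A1] class_part_supported[OF supported_A2]
    using assms by auto
  then have "class_part n (euler * dilate f) = 0"
    by (simp add: class_part_mult_dilate)
  then show ?thesis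
    by (metis class_part_nth fps_zero_nth)
qed

lemma fcong_scale_5: "fcong 5 f g \<Longrightarrow> fcong 25 (5 * f) (5 * g)"
  using fcong_scale[of 5 f g 5] by (simp add: numeral_fps_const)

lemma fcong_dvd_nth_iff: "fcong m f g \<Longrightarrow> m dvd fps_nth f n \<longleftrightarrow> m dvd fps_nth g n"
  unfolding fcong_iff by (metis dvd_diff_left_iff dvd_diff_right_iff)

lemma class_part_dvd_nth_iff:
  assumes "fcong m (class_part r f) (fps_X ^ r * dilate g)" "r < 5"
  shows "m dvd fps_nth f (5 * n + r) \<longleftrightarrow> m dvd fps_nth g n"
  using fcong_class_part_nth[OF assms, of n] by (metis dvd_diff_left_iff dvd_diff_right_iff)

section \<open>Class parts modulo powers of 5\<close>

lemma fcong_euler_norm_plus_5_euler_mixed_power_4: "fcong 25 ((euler_norm + 5 * euler_mixed) ^ 4) (euler_norm ^ 4 + 20 * (euler_norm ^ 3 * euler_mixed))"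
proof (rule fcong_multipleI)
  show "(euler_norm + 5 * euler_mixed) ^ 4 = euler_norm ^ 4 + 20 * (euler_norm ^ 3 * euler_mixed) +
      fps_const 25 * (6 * euler_norm ^ 2 * euler_mixed ^ 2 + 20 * euler_norm * euler_mixed ^ 3 + 25 * euler_mixed ^ 4)"
    unfolding numeral_fps_const[symmetric] by algebra
qed

lemma class_part_euler_norm_mult: "class_part r (euler_norm ^ k * f) = euler_norm ^ k * class_part r f"
  using class_part_mult_dilate[of r f "(euler ^ 6 * dilate euler_inv) ^ k"]
  by (simp only: euler_norm_dilate dilate_power mult.commute)

lemma class_part_euler_norm_power: "class_part 0 (euler_norm ^ k) = euler_norm ^ k"
  unfolding euler_norm_dilate dilate_power [symmetric] by (simp add: class_part_supported[OF supported_dilate])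

text \<open>Expand \<open>(euler_norm + 5 * euler_mixed) ^ 4\<close> modulo 25; the linear term
  drops out because \<open>euler_mixed\<close> has no exponents divisible by 5.\<close>

lemma class_part_euler_power_20: "fcong 25 (class_part 0 (euler ^ 20)) (euler_norm ^ 4)"
proof -
  have "euler ^ 20 = (euler_norm + 5 * euler_mixed) ^ 4"
    unfolding euler_power_5[symmetric] by (simp flip: power_mult)
  then have "fcong 25 (euler ^ 20) (euler_norm ^ 4 + 20 * (euler_norm ^ 3 * euler_mixed))"
    using fcong_euler_norm_plus_5_euler_mixed_power_4 by simp
  then have "fcong 25 (class_part 0 (euler ^ 20)) (class_part 0 (euler_norm ^ 4 + 20 * (euler_norm ^ 3 * euler_mixed)))"
    by (rule class_part_fcong)
  also have "class_part 0 (euler_norm ^ 4 + 20 * (euler_norm ^ 3 * euler_mixed)) = euler_norm ^ 4"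
    by (simp only: class_part_add class_part_numeral_mult class_part_euler_norm_mult class_part_euler_mixed class_part_euler_norm_power) simp
  finally show ?thesis .
qed

text \<open>The leading term contributes \<open>A1 * euler_norm ^ 4\<close> once and the linear term
  contributes it 20 times; the remaining multiple of \<open>A1 ^ 6\<close> has coefficient -
  100.\<close>

lemma class_part_euler_power_21: "fcong 25 (class_part 1 (euler ^ 21)) (21 * (A1 * euler_norm ^ 4))"
proof -
  have "euler ^ 21 = euler * (euler ^ 5) ^ 4"
    by (simp flip: power_mult power_Suc)
  then have "fcong 25 (euler ^ 21) (euler * (euler_norm ^ 4 + 20 * (euler_norm ^ 3 * euler_mixed)))"
    unfolding euler_power_5 using fcong_euler_norm_plus_5_euler_mixed_power_4 by (auto intro: fcong_mult)
  also have "euler * (euler_norm ^ 4 + 20 * (euler_norm ^ 3 * euler_mixed)) = euler_norm ^ 4 * euler + 20 * (euler_norm ^ 3 * (euler * euler_mixed))"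
    by (simp add: algebra_simps)
  finally have "fcong 25 (class_part 1 (euler ^ 21)) (class_part 1 (euler_norm ^ 4 * euler + 20 * (euler_norm ^ 3 * (euler * euler_mixed))))"
    by (rule class_part_fcong)
  also have "class_part 1 (euler_norm ^ 4 * euler + 20 * (euler_norm ^ 3 * (euler * euler_mixed))) =
      euler_norm ^ 4 * A1 + 20 * (euler_norm ^ 3 * (A1 * euler_norm - 5 * A1 ^ 6))"
  proof -
    have "class_part 1 euler = A1"
      unfolding euler_dissection class_part_add class_part_supported[OF supported_A0]
        class_part_supported[OF supported_A1] class_part_supported[OF supported_A2] by simp
    then show ?thesis
      by (simp only: class_part_add class_part_numeral_mult class_part_euler_norm_mult class_part_euler_mult_euler_mixed)
  qed
  also have "\<dots> = 21 * (A1 * euler_norm ^ 4) + fps_const 25 * (- 4 * euler_norm ^ 3 * A1 ^ 6)"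
    unfolding numeral_fps_const[symmetric] by algebra
  also have "fcong 25 \<dots> (21 * (A1 * euler_norm ^ 4))"
    by (rule fcong_multipleI) (rule refl)
  finally show ?thesis .
qed

text \<open>Expand \<open>(euler_norm + 5 * euler_mixed) ^ 21\<close>. Terms of degree at least 3 in
  \<open>euler_mixed\<close> vanish modulo 625, the linear one has no class 0 part, and the class 0
  part of the quadratic one is divisible by 625.\<close>

lemma class_part_euler_power_105: "fcong 625 (class_part 0 (euler ^ 105)) (euler_norm ^ 21)"
proof -
  \<comment> \<open>From \<open>k = 4\<close> on the power of 5 suffices; for \<open>k = 3\<close>
    the fourth factor 5 comes from the binomial coefficient 1330.\<close>
  have "625 dvd int (21 choose k) * 5 ^ k" if "k \<ge> 3" for k
  proof (cases "k = 3")
    case True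
    then show ?thesis
      by (simp add: binomial_fact' fact_numeral numeral_eq_Suc)
  next
    case False
    then have "(5 :: int) ^ 4 dvd 5 ^ k"
      using that by (intro le_imp_power_dvd) auto
    then show ?thesis
      by simp
  qed
  then obtain c where c: "int (21 choose k) * 5 ^ k = 625 * c k" if "k \<ge> 3" for k
    unfolding dvd_def by metis
  let ?t = "\<lambda>k. of_nat (21 choose k) * (5 * euler_mixed) ^ k * euler_norm ^ (21 - k)"
  have t: "?t k = fps_const 625 * (fps_const (c k) * euler_mixed ^ k * euler_norm ^ (21 - k))" if "k \<ge> 3" for k
  proof -
    have "?t k = of_int (int (21 choose k) * 5 ^ k) * (euler_mixed ^ k * euler_norm ^ (21 - k))"
      by (simp add: power_mult_distrib mult_ac)
    also have "\<dots> = of_int 625 * (of_int (c k) * euler_mixed ^ k * euler_norm ^ (21 - k))"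
      unfolding c[OF that] of_int_mult by (simp only: mult_ac)
    finally show ?thesis
      by (simp only: fps_of_int [symmetric] of_int_eq_id id_apply)
  qed
  have "euler ^ 105 = (5 * euler_mixed + euler_norm) ^ 21"
    unfolding add.commute[of "5 * euler_mixed"] euler_power_5[symmetric] by (simp flip: power_mult)
  also have "\<dots> = (\<Sum>k\<le>21. ?t k)"
    by (rule binomial_ring)
  also have "\<dots> = (\<Sum>k\<in>{0, 1, 2}. ?t k) + (\<Sum>k = 3..21. ?t k)"
  proof -
    have "{..21} = {0, 1, 2} \<union> {3..21::nat}"
      by auto
    then show ?thesis
      by (simp only:) (rule sum.union_disjoint, auto)
  qed
  also have "(\<Sum>k = 3..21. ?t k) = fps_const 625 * (\<Sum>k = 3..21. fps_const (c k) * euler_mixed ^ k * euler_norm ^ (21 - k))"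
    unfolding sum_distrib_left by (intro sum.cong t) auto
  also have "(\<Sum>k\<in>{0, 1, 2}. ?t k) = euler_norm ^ 21 + 105 * (euler_norm ^ 20 * euler_mixed) + 5250 * (euler_norm ^ 19 * euler_mixed ^ 2)"
    by (simp add: choose_two power_mult_distrib)
  finally have "fcong 625 (euler ^ 105) (euler_norm ^ 21 + 105 * (euler_norm ^ 20 * euler_mixed) + 5250 * (euler_norm ^ 19 * euler_mixed ^ 2))"
    by (rule fcong_multipleI)
  then have "fcong 625 (class_part 0 (euler ^ 105)) (class_part 0 (euler_norm ^ 21 + 105 * (euler_norm ^ 20 * euler_mixed) + 5250 * (euler_norm ^ 19 * euler_mixed ^ 2)))"
    by (rule class_part_fcong)
  \<comment> \<open>Here \<open>5250 * 10 = 84 * 625\<close>.\<close>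
  also have "class_part 0 (euler_norm ^ 21 + 105 * (euler_norm ^ 20 * euler_mixed) + 5250 * (euler_norm ^ 19 * euler_mixed ^ 2)) =
      euler_norm ^ 21 + fps_const 625 * (- 84 * euler_norm ^ 19 * (part_monom 5 5 0 + part_monom 0 10 0 + part_monom 0 5 5))"
    unfolding class_part_add class_part_numeral_mult class_part_euler_norm_mult class_part_euler_mixed class_part_euler_norm_power class_part_euler_mixed_square
      numeral_fps_const[symmetric]
    by algebra
  also have "fcong 625 \<dots> (euler_norm ^ 21)"
    by (rule fcong_multipleI) (rule refl)
  finally show ?thesis .
qed

section \<open>The congruences\<close>

lemma power_euler_inv_cancel: "euler ^ (n + 1) * euler_inv = euler ^ n"
proof -
  have "euler ^ (n + 1) * euler_inv = euler ^ n * (euler * euler_inv)"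
    by (simp add: mult_ac)
  then show ?thesis
    by (simp add: euler_inv)
qed

text \<open>The exponent is - 1/6 modulo 25, as \<open>6 * 4 = 24\<close>. Extracting class 4
  produces a factor 5 times a series that is in q^5 modulo 5.\<close>

lemma euler_power_minus_1_sixth:
  assumes "n mod 5 \<noteq> 0"
  shows "25 dvd fps_nth (euler ^ (4 + 25 * w)) (5 * n + 4)"
proof -
  define F where "F = 5 * (- (dilate euler ^ 4 * euler ^ (5 * w)))"
  have "euler ^ (4 + 25 * w) = euler ^ 4 * (euler ^ 25) ^ w"
    by (simp add: power_add power_mult)
  also have "fcong 25 \<dots> (euler ^ 4 * dilate (euler ^ (5 * w)))"
    unfolding dilate_power power_mult by (intro fcong_mult fcong_power fcong_refl fcong_euler_power_25)
  finally have "fcong 25 (class_part 4 (euler ^ (4 + 25 * w))) (class_part 4 (euler ^ 4 * dilate (euler ^ (5 * w))))"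
    by (rule class_part_fcong)
  also have "class_part 4 (euler ^ 4 * dilate (euler ^ (5 * w))) = fps_X ^ 4 * dilate F"
  proof -
    have "A1 ^ 4 = fps_X ^ 4 * dilate (dilate euler ^ 4)"
      by (simp add: A1_dilate dilate_power power_mult_distrib)
    then show ?thesis
      unfolding class_part_mult_dilate class_part_euler_power_4 F_def
      by (simp add: dilate_mult fps_compose_uminus mult_ac)
  qed
  finally have "25 dvd fps_nth (euler ^ (4 + 25 * w)) (5 * n + 4) \<longleftrightarrow> 25 dvd fps_nth F n"
    by (rule class_part_dvd_nth_iff) simp
  \<comment> \<open>The explicit factor 5 lowers the remaining modulus to 5, where a fifth power of
    \<open>euler\<close> becomes a series in q^5.\<close>
  also have "fcong 25 F (5 * (- dilate (euler ^ 4 * euler ^ w)))"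
  proof -
    have "fcong 5 (dilate euler ^ 4 * (euler ^ 5) ^ w) (dilate euler ^ 4 * dilate euler ^ w)"
      by (intro fcong_mult fcong_power fcong_refl fcong_euler_power_5)
    then have "fcong 5 (- 1 * (dilate euler ^ 4 * (euler ^ 5) ^ w)) (- 1 * (dilate euler ^ 4 * dilate euler ^ w))"
      by (rule fcong_mult[OF fcong_refl])
    then show ?thesis
      unfolding F_def power_mult dilate_mult dilate_power by (intro fcong_scale_5) (simp only: mult_minus1)
  qed
  then have "25 dvd fps_nth F n \<longleftrightarrow> 25 dvd fps_nth (dilate (5 * (- (euler ^ 4 * euler ^ w)))) n"
    by (simp only: fcong_dvd_nth_iff dilate_mult numeral_compose fps_compose_uminus)
  finally show ?thesis
    by (simp only: dilate_nth_eq_0[OF assms] dvd_0_right simp_thms)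
qed

text \<open>The exponent is - 5/6 modulo 625, as \<open>6 * 520 = 3120\<close>. Two extractions, of
  class 0 and then class 4, lead to Ramanujan's factor 5 times a series that is in q^5 modulo
  5.\<close>

lemma euler_power_minus_5_sixths:
  assumes "n mod 5 \<noteq> 0"
  shows "25 dvd fps_nth (euler ^ (520 + 625 * w)) (25 * n + 20)"
proof -
  have index: "5 * (5 * n + 4) + 0 = 25 * n + 20"
    by simp
  \<comment> \<open>The exponent is \<open>20 + 125 u\<close>, and
    \<open>5 * (1 + u) = 25 * (1 + w)\<close>.\<close>
  let ?u = "4 + 5 * w"
  \<comment> \<open>\<open>F\<close> is what the first extraction leaves modulo 25, and
    \<open>H\<close> is what the second extraction leaves of \<open>F\<close>.\<close>
  define F where "F = euler_inv * dilate (euler ^ (5 * (1 + ?u)) * euler_inv ^ 4)"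
  define H where "H = 5 * dilate euler ^ 5 * euler_inv ^ 10 * euler ^ (25 * (1 + w))"
  have "euler ^ (520 + 625 * w) = euler ^ 20 * (euler ^ 125) ^ ?u"
    by (simp flip: power_add power_mult)
  also have "fcong 25 \<dots> (euler ^ 20 * dilate (euler ^ (25 * ?u)))"
    unfolding dilate_power power_mult
    by (intro fcong_mult fcong_power fcong_refl fcong_modulus_dvd[OF fcong_euler_power_125]) simp
  finally have "fcong 25 (class_part 0 (euler ^ (520 + 625 * w))) (class_part 0 (euler ^ 20 * dilate (euler ^ (25 * ?u))))"
    by (rule class_part_fcong)
  also have "\<dots> = class_part 0 (euler ^ 20) * dilate (euler ^ (25 * ?u))"
    by (rule class_part_mult_dilate)
  also have "fcong 25 \<dots> (euler_norm ^ 4 * dilate (euler ^ (25 * ?u)))"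
    by (intro fcong_mult class_part_euler_power_20 fcong_refl)
  also have "euler_norm ^ 4 * dilate (euler ^ (25 * ?u)) = fps_X ^ 0 * dilate (euler ^ (24 + 25 * ?u) * dilate (euler_inv ^ 4))"
    unfolding euler_norm_dilate by (simp add: power_add dilate_mult dilate_power power_mult_distrib mult_ac flip: power_mult)
  finally have "25 dvd fps_nth (euler ^ (520 + 625 * w)) (5 * (5 * n + 4) + 0) \<longleftrightarrow>
      25 dvd fps_nth (euler ^ (24 + 25 * ?u) * dilate (euler_inv ^ 4)) (5 * n + 4)"
    by (rule class_part_dvd_nth_iff) simp
  also have "euler ^ (24 + 25 * ?u) * dilate (euler_inv ^ 4) = euler_inv * (euler ^ 25) ^ (1 + ?u) * dilate (euler_inv ^ 4)"
    using power_euler_inv_cancel[of "24 + 25 * ?u"]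
    by (simp add: mult_ac flip: power_mult)
  also have "fcong 25 \<dots> (euler_inv * (dilate euler ^ 5) ^ (1 + ?u) * dilate (euler_inv ^ 4))"
    by (intro fcong_mult fcong_power fcong_refl fcong_euler_power_25)
  then have "25 dvd fps_nth (euler_inv * (euler ^ 25) ^ (1 + ?u) * dilate (euler_inv ^ 4)) (5 * n + 4) \<longleftrightarrow>
      25 dvd fps_nth F (5 * n + 4)"
    by (simp add: fcong_dvd_nth_iff F_def dilate_mult dilate_power mult_ac flip: power_mult)
  also have "25 dvd fps_nth F (5 * n + 4) \<longleftrightarrow> 25 dvd fps_nth H n"
  proof (rule class_part_dvd_nth_iff)
    have e: "5 * (1 + ?u) = 25 * (1 + w)"
      by simp
    have "class_part 4 F = fps_X ^ 4 * dilate (5 * dilate euler ^ 5 * euler_inv ^ 6) * dilate (euler ^ (5 * (1 + ?u)) * euler_inv ^ 4)"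
      by (simp only: F_def class_part_mult_dilate class_part_euler_inv)
    also have "\<dots> = fps_X ^ 4 * dilate ((5 * dilate euler ^ 5 * euler_inv ^ 6) * (euler ^ (5 * (1 + ?u)) * euler_inv ^ 4))"
      by (simp only: dilate_mult mult.assoc)
    also have "(5 * dilate euler ^ 5 * euler_inv ^ 6) * (euler ^ (5 * (1 + ?u)) * euler_inv ^ 4) = H"
      unfolding H_def e by (simp add: mult_ac flip: power_add)
    finally have "class_part 4 F = fps_X ^ 4 * dilate H" .
    then show "fcong 25 (class_part 4 F) (fps_X ^ 4 * dilate H)"
      by simp
  qed simp
  also have "fcong 25 H (5 * (dilate euler ^ 5 * dilate euler_inv ^ 2 * (dilate euler ^ 5) ^ (1 + w)))"
  proof -
    have "H = 5 * (dilate euler ^ 5 * (euler_inv ^ 5) ^ 2 * (euler ^ 25) ^ (1 + w))"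
    proof -
      have "euler_inv ^ 10 = (euler_inv ^ 5) ^ 2"
        by (simp flip: power_mult)
      then show ?thesis
        unfolding H_def power_mult by (simp only: mult.assoc)
    qed
    then show ?thesis
      by (simp only:) (intro fcong_scale_5 fcong_mult fcong_power fcong_refl fcong_euler_inv_power_5
          fcong_modulus_dvd[OF fcong_euler_power_25], simp)
  qed
  then have "25 dvd fps_nth H n \<longleftrightarrow>
      25 dvd fps_nth (dilate (5 * (euler ^ 5 * euler_inv ^ 2 * (euler ^ 5) ^ (1 + w)))) n"
    by (simp only: fcong_dvd_nth_iff dilate_mult dilate_power numeral_compose)
  finally show ?thesis
    by (simp only: index dilate_nth_eq_0[OF assms] dvd_0_right simp_thms)
qed

text \<open>The exponent is 1/6 modulo 625, as \<open>6 * 521 = 3126\<close>. The same double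
  descent as for - 5/6, starting from class 1, leaves one factor \<open>euler\<close>, so the
  missing classes 3 and 4 give the vanishing.\<close>

lemma euler_power_1_sixth:
  assumes "n mod 5 = 3 \<or> n mod 5 = 4"
  shows "25 dvd fps_nth (euler ^ (521 + 625 * w)) (25 * n + 21)"
proof -
  have index: "5 * (5 * n + 4) + 1 = 25 * n + 21"
    by simp
  let ?u = "4 + 5 * w"
  \<comment> \<open>The sign and the factor \<open>euler\<close> come from \<open>A1\<close>, the
    constant 21 from \<open>class_part_euler_power_21\<close>, and \<open>euler_inv ^ 4\<close> from
    the fourth power of the norm.\<close>
  define c where "c = - 21 * (euler * euler_inv ^ 4)"
  define F where "F = euler_inv * dilate (euler ^ (5 * (1 + ?u)) * c)"
  define H where "H = 5 * dilate euler ^ 5 * (c * euler_inv ^ 6) * euler ^ (25 * (1 + w))"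
  have "euler ^ (521 + 625 * w) = euler ^ 21 * (euler ^ 125) ^ ?u"
    by (simp flip: power_add power_mult)
  also have "fcong 25 \<dots> (euler ^ 21 * dilate (euler ^ (25 * ?u)))"
    unfolding dilate_power power_mult
    by (intro fcong_mult fcong_power fcong_refl fcong_modulus_dvd[OF fcong_euler_power_125]) simp
  finally have "fcong 25 (class_part 1 (euler ^ (521 + 625 * w))) (class_part 1 (euler ^ 21 * dilate (euler ^ (25 * ?u))))"
    by (rule class_part_fcong)
  also have "\<dots> = class_part 1 (euler ^ 21) * dilate (euler ^ (25 * ?u))"
    by (rule class_part_mult_dilate)
  also have "fcong 25 \<dots> (21 * (A1 * euler_norm ^ 4) * dilate (euler ^ (25 * ?u)))"
    by (intro fcong_mult class_part_euler_power_21 fcong_refl)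
  also have "21 * (A1 * euler_norm ^ 4) * dilate (euler ^ (25 * ?u)) =
      fps_X ^ 1 * dilate (euler ^ (24 + 25 * ?u) * dilate (c))"
  proof -
    have "dilate (dilate c) = - 21 * (dilate (dilate euler) * dilate (dilate (euler_inv ^ 4)))"
      by (simp only: c_def dilate_mult neg_numeral_compose)
    moreover have "euler_norm ^ 4 = dilate (euler ^ 24) * dilate (dilate (euler_inv ^ 4))"
      by (simp add: euler_norm_dilate dilate_mult dilate_power power_mult_distrib flip: power_mult)
    ultimately show ?thesis
      unfolding A1_dilate power_add dilate_mult by (simp only: mult_ac mult_minus_left mult_minus_right power_one_right)
  qed
  finally have "25 dvd fps_nth (euler ^ (521 + 625 * w)) (5 * (5 * n + 4) + 1) \<longleftrightarrow>
      25 dvd fps_nth (euler ^ (24 + 25 * ?u) * dilate (c)) (5 * n + 4)"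
    by (rule class_part_dvd_nth_iff) simp
  also have "euler ^ (24 + 25 * ?u) * dilate (c) =
      euler_inv * (euler ^ 25) ^ (1 + ?u) * dilate (c)"
    using power_euler_inv_cancel[of "24 + 25 * ?u"]
    by (simp add: mult_ac flip: power_mult)
  also have "fcong 25 \<dots> (euler_inv * (dilate euler ^ 5) ^ (1 + ?u) * dilate (c))"
    by (intro fcong_mult fcong_power fcong_refl fcong_euler_power_25)
  then have "25 dvd fps_nth (euler_inv * (euler ^ 25) ^ (1 + ?u) * dilate (c)) (5 * n + 4) \<longleftrightarrow>
      25 dvd fps_nth F (5 * n + 4)"
    by (simp add: fcong_dvd_nth_iff F_def dilate_mult dilate_power mult_ac flip: power_mult)
  also have "25 dvd fps_nth F (5 * n + 4) \<longleftrightarrow> 25 dvd fps_nth H n"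
  proof (rule class_part_dvd_nth_iff)
    have e: "5 * (1 + ?u) = 25 * (1 + w)"
      by simp
    have "class_part 4 F = fps_X ^ 4 * dilate (5 * dilate euler ^ 5 * euler_inv ^ 6) * dilate (euler ^ (5 * (1 + ?u)) * c)"
      by (simp only: F_def class_part_mult_dilate class_part_euler_inv)
    also have "\<dots> = fps_X ^ 4 * dilate ((5 * dilate euler ^ 5 * euler_inv ^ 6) * (euler ^ (5 * (1 + ?u)) * c))"
      by (simp only: dilate_mult mult.assoc)
    also have "(5 * dilate euler ^ 5 * euler_inv ^ 6) * (euler ^ (5 * (1 + ?u)) * c) = H"
      unfolding H_def e by (simp add: mult_ac flip: power_add)
    finally have "class_part 4 F = fps_X ^ 4 * dilate H" .
    then show "fcong 25 (class_part 4 F) (fps_X ^ 4 * dilate H)"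
      by simp
  qed simp
  also have "fcong 25 H (5 * (dilate euler ^ 5 * (- 21 * euler * dilate euler_inv ^ 2) * (dilate euler ^ 5) ^ (1 + w)))"
  proof -
    have "H = 5 * (dilate euler ^ 5 * (- 21 * euler * (euler_inv ^ 5) ^ 2) * (euler ^ 25) ^ (1 + w))"
      unfolding H_def c_def by (simp add: mult_ac flip: power_mult power_add)
    then show ?thesis
      by (simp only:) (intro fcong_scale_5 fcong_mult fcong_power fcong_refl fcong_euler_inv_power_5
          fcong_modulus_dvd[OF fcong_euler_power_25], simp)
  qed
  then have "25 dvd fps_nth H n \<longleftrightarrow> 25 dvd fps_nth
      (5 * (dilate euler ^ 5 * (- 21 * euler * dilate euler_inv ^ 2) * (dilate euler ^ 5) ^ (1 + w))) n"
    by (rule fcong_dvd_nth_iff)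
  also have "5 * (dilate euler ^ 5 * (- 21 * euler * dilate euler_inv ^ 2) * (dilate euler ^ 5) ^ (1 + w)) =
      euler * dilate (5 * (euler ^ 5 * (- 21 * euler_inv ^ 2) * (euler ^ 5) ^ (1 + w)))"
    unfolding dilate_mult dilate_power numeral_compose neg_numeral_compose by (simp only: mult_ac)
  finally show ?thesis
    by (simp only: index euler_mult_dilate_nth_eq_0[OF assms] dvd_0_right simp_thms)
qed

text \<open>The exponent is 5/6 modulo 3125, as \<open>6 * 2605 = 15630\<close>. A single extraction
  of class 0 leaves, modulo 625, \<open>euler\<close> times a series in q^5.\<close>

lemma euler_power_5_sixths:
  assumes "n mod 5 = 3 \<or> n mod 5 = 4"
  shows "625 dvd fps_nth (euler ^ (2605 + 3125 * w)) (5 * n)"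
proof -
  have index: "5 * n + 0 = 5 * n"
    by simp
  let ?u = "4 + 5 * w"
  have "euler ^ (2605 + 3125 * w) = euler ^ 105 * (euler ^ 625) ^ ?u"
    by (simp flip: power_add power_mult)
  also have "fcong 625 \<dots> (euler ^ 105 * dilate (euler ^ (125 * ?u)))"
    unfolding dilate_power power_mult by (intro fcong_mult fcong_power fcong_refl fcong_euler_power_625)
  finally have "fcong 625 (class_part 0 (euler ^ (2605 + 3125 * w))) (class_part 0 (euler ^ 105 * dilate (euler ^ (125 * ?u))))"
    by (rule class_part_fcong)
  also have "\<dots> = class_part 0 (euler ^ 105) * dilate (euler ^ (125 * ?u))"
    by (rule class_part_mult_dilate)
  also have "fcong 625 \<dots> (euler_norm ^ 21 * dilate (euler ^ (125 * ?u)))"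
    by (intro fcong_mult class_part_euler_power_105 fcong_refl)
  also have "euler_norm ^ 21 * dilate (euler ^ (125 * ?u)) =
      fps_X ^ 0 * dilate (euler * (euler ^ 625) ^ (1 + w) * dilate (euler_inv ^ 21))"
  proof -
    \<comment> \<open>\<open>126 + 125 u = 1 + 625 (1 + w)\<close>: all but one factor
      \<open>euler\<close> fall under the congruence modulo 625.\<close>
    have "euler ^ 126 * euler ^ (125 * ?u) = euler * (euler ^ 625) ^ (1 + w)"
      by (simp flip: power_add power_mult power_Suc)
    then have "dilate (euler ^ 126 * euler ^ (125 * ?u)) = dilate (euler * (euler ^ 625) ^ (1 + w))"
      by (rule arg_cong)
    moreover have "euler_norm ^ 21 = dilate (euler ^ 126) * dilate (dilate (euler_inv ^ 21))"
      by (simp add: euler_norm_dilate dilate_mult dilate_power power_mult_distrib flip: power_mult)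
    then have "euler_norm ^ 21 * dilate (euler ^ (125 * ?u)) = dilate (euler ^ 126 * euler ^ (125 * ?u)) * dilate (dilate (euler_inv ^ 21))"
      unfolding dilate_mult by (simp only: mult_ac)
    ultimately show ?thesis
      by (simp only: dilate_mult power_0 mult_1)
  qed
  finally have "625 dvd fps_nth (euler ^ (2605 + 3125 * w)) (5 * n + 0) \<longleftrightarrow>
      625 dvd fps_nth (euler * (euler ^ 625) ^ (1 + w) * dilate (euler_inv ^ 21)) n"
    by (rule class_part_dvd_nth_iff) simp
  also have "fcong 625 (euler * (euler ^ 625) ^ (1 + w) * dilate (euler_inv ^ 21))
      (euler * (dilate euler ^ 125) ^ (1 + w) * dilate (euler_inv ^ 21))"
    by (intro fcong_mult fcong_power fcong_refl fcong_euler_power_625)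
  then have "625 dvd fps_nth (euler * (euler ^ 625) ^ (1 + w) * dilate (euler_inv ^ 21)) n \<longleftrightarrow>
      625 dvd fps_nth (euler * dilate ((euler ^ 125) ^ (1 + w) * euler_inv ^ 21)) n"
    by (simp only: fcong_dvd_nth_iff dilate_mult dilate_power mult_ac)
  finally show ?thesis
    by (simp only: index euler_mult_dilate_nth_eq_0[OF assms] dvd_0_right simp_thms)
qed

section \<open>Return to the rational exponents\<close>

lemma p_pow_minus_1_sixth:
  assumes "n mod 5 \<noteq> 0"
  shows "[p_pow (-1/6) (5 * n + 4) = 0] (ratmod 25)"
  using p_pow_ratmod_transfer[of 5 6 4 "-1" 2 2 "5 * n + 4"] euler_power_minus_1_sixth[OF assms]
  by (simp add: cong_def)

lemma p_pow_1_sixth: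
  assumes "n mod 5 = 3 \<or> n mod 5 = 4"
  shows "[p_pow (1/6) (25 * n + 21) = 0] (ratmod 25)"
  using p_pow_ratmod_transfer[of 5 6 521 1 4 2 "25 * n + 21"] euler_power_1_sixth[OF assms]
  by (simp add: cong_def)

lemma p_pow_minus_5_sixths:
  assumes "n mod 5 \<noteq> 0"
  shows "[p_pow (-5/6) (25 * n + 20) = 0] (ratmod 25)"
  using p_pow_ratmod_transfer[of 5 6 520 "-5" 4 2 "25 * n + 20"] euler_power_minus_5_sixths[OF assms]
  by (simp add: cong_def)

lemma p_pow_5_sixths:
  assumes "n mod 5 = 3 \<or> n mod 5 = 4"
  shows "[p_pow (5/6) (5 * n) = 0] (ratmod 625)"
  using p_pow_ratmod_transfer[of 5 6 2605 5 5 4 "5 * n"] euler_power_5_sixths[OF assms]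
  by (simp add: cong_def)

theorem theorem1p3:
  fixes n :: nat
  shows "(\<forall>r\<in>{9, 14, 19, 24}. [p_pow (-1/6) (25 * n + r) = 0] (ratmod 25)) \<and>
         (\<forall>r\<in>{96, 121}. [p_pow (1/6) (125 * n + r) = 0] (ratmod 25)) \<and>
         (\<forall>r\<in>{95, 120}. [p_pow (-5/6) (125 * n + r) = 0] (ratmod 25)) \<and>
         (\<forall>r\<in>{15, 20}. [p_pow (5/6) (25 * n + r) = 0] (ratmod 125)) \<and>
         (\<forall>r\<in>{65, 70}. [p_pow (5/6) (125 * n + r) = 0] (ratmod 625))"
proof -
  \<comment> \<open>The claims modulo 125 are obtained from divisibility by 625 on the same
    progressions.\<close>
  have dvd: "[x = 0] (ratmod 625) \<Longrightarrow> [x = 0] (ratmod 125)" for x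
    unfolding rat_cong_0_def by (rule dvd_trans[of 125 625]) simp_all
  have "[p_pow (-1/6) (25 * n + 9) = 0] (ratmod 25)"
    using p_pow_minus_1_sixth[of "5 * n + 1", unfolded mod_mult_self4] by (simp add: add.commute)
  moreover have "[p_pow (-1/6) (25 * n + 14) = 0] (ratmod 25)"
    using p_pow_minus_1_sixth[of "5 * n + 2", unfolded mod_mult_self4] by (simp add: add.commute)
  moreover have "[p_pow (-1/6) (25 * n + 19) = 0] (ratmod 25)"
    using p_pow_minus_1_sixth[of "5 * n + 3", unfolded mod_mult_self4] by (simp add: add.commute)
  moreover have "[p_pow (-1/6) (25 * n + 24) = 0] (ratmod 25)"
    using p_pow_minus_1_sixth[of "5 * n + 4", unfolded mod_mult_self4] by (simp add: add.commute)
  moreover have "[p_pow (1/6) (125 * n + 96) = 0] (ratmod 25)"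
    using p_pow_1_sixth[of "5 * n + 3", unfolded mod_mult_self4] by (simp add: add.commute)
  moreover have "[p_pow (1/6) (125 * n + 121) = 0] (ratmod 25)"
    using p_pow_1_sixth[of "5 * n + 4", unfolded mod_mult_self4] by (simp add: add.commute)
  moreover have "[p_pow (-5/6) (125 * n + 95) = 0] (ratmod 25)"
    using p_pow_minus_5_sixths[of "5 * n + 3", unfolded mod_mult_self4] by (simp add: add.commute)
  moreover have "[p_pow (-5/6) (125 * n + 120) = 0] (ratmod 25)"
    using p_pow_minus_5_sixths[of "5 * n + 4", unfolded mod_mult_self4] by (simp add: add.commute)
  moreover have "[p_pow (5/6) (25 * n + 15) = 0] (ratmod 625)"
    using p_pow_5_sixths[of "5 * n + 3", unfolded mod_mult_self4] by (simp add: add.commute)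
  moreover have "[p_pow (5/6) (25 * n + 20) = 0] (ratmod 625)"
    using p_pow_5_sixths[of "5 * n + 4", unfolded mod_mult_self4] by (simp add: add.commute)
  \<comment> \<open>These progressions refine the previous two, since
    \<open>65 = 25 * 2 + 15\<close> and \<open>70 = 25 * 2 + 20\<close>.\<close>
  moreover have "[p_pow (5/6) (125 * n + 65) = 0] (ratmod 625)"
    using p_pow_5_sixths[of "5 * (5 * n + 2) + 3", unfolded mod_mult_self4] by (simp add: add.commute)
  moreover have "[p_pow (5/6) (125 * n + 70) = 0] (ratmod 625)"
    using p_pow_5_sixths[of "5 * (5 * n + 2) + 4", unfolded mod_mult_self4] by (simp add: add.commute)
  ultimately show ?thesis
    using dvd by simp
qed

end
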